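(* Let $A$ be a unital $C^*$-algebra, let $G$ be a compact group, and let $\alpha$ be a strongly continuous action of $G$ on $A$ by $*$-automorphisms which is ergodic, i.e. the only elements $a\in A$ with $\alpha_x(a)=a$ for all $x\in G$ are those in $\mathbb C1$. Let $\ell$ be a continuous length function on $G$, and define $L(a)=\sup\{\|\alpha_x(a)-a\|/\ell(x): x\in G,\ x\neq e\}$ for $a\in A$ (value $+\infty$ allowed). Then the restriction of $L$ to the order-unit space $\{a\in A_{sa}: L(a)<\infty\}$ is a Lip-norm, i.e. $(\{a\in A_{sa}: L(a)<\infty\},L)$ is a compact quantum metric space.
   Context: A continuous length function on $G$ is a continuous $\ell:G\to\mathbb R^+$ with $\ell(xy)\le\ell(x)+\ell(y)$, $\ell(x^{-1})=\ell(x)$, and $\ell(x)=0$ iff $x=e$. $A_{sa}$ is the set of self-adjoint elements of $A$, an order-unit space with order unit $1$. For an order-unit space $A$ (a real space of self-adjoint operators containing the identity, with operator order and norm), its state space $S(A)$ is the set of positive linear functionals $\mu$ with $\mu(1)=1$, with the weak-$*$ topology. A Lip-norm on an order-unit space $A$ is a finite-valued seminorm $L$ with $L(1)=0$ such that the topology on $S(A)$ from the metric $\rho_L(\mu,\nu)=\sup\{|\mu(a)-\nu(a)|: L(a)\le 1\}$ coincides with the weak-$*$ topology. A compact quantum metric space is a pair $(A,L)$ with $L$ a Lip-norm on the order-unit space $A$. *)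

theory Defs
  imports "HOL-Analysis.Analysis"
begin

text \<open>A unital C*-algebra is modelled on a type 'a that is a real Banach algebra with unit
(norm 1 = 1), equipped with a complex scalar multiplication sm extending the real one
(turning it into a complex Banach algebra) and an involution st satisfying the C*-identity.\<close>

definition unital_cstar_algebra ::
  "(complex \<Rightarrow> 'a::{real_normed_algebra_1,banach} \<Rightarrow> 'a) \<Rightarrow> ('a \<Rightarrow> 'a) \<Rightarrow> bool" where
  "unital_cstar_algebra sm st \<longleftrightarrow>
     (\<forall>r a. sm (complex_of_real r) a = r *\<^sub>R a) \<and>
     (\<forall>a. sm 1 a = a) \<and>
     (\<forall>c d a. sm (c * d) a = sm c (sm d a)) \<and>
     (\<forall>c d a. sm (c + d) a = sm c a + sm d a) \<and>
     (\<forall>c a b. sm c (a + b) = sm c a + sm c b) \<and>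
     (\<forall>c a b. sm c (a * b) = sm c a * b) \<and>
     (\<forall>c a b. sm c (a * b) = a * sm c b) \<and>
     (\<forall>c a. norm (sm c a) = cmod c * norm a) \<and>
     (\<forall>a b. st (a + b) = st a + st b) \<and>
     (\<forall>c a. st (sm c a) = sm (cnj c) (st a)) \<and>
     (\<forall>a. st (st a) = a) \<and>
     (\<forall>a b. st (a * b) = st b * st a) \<and>
     (\<forall>a. norm (st a * a) = (norm a)\<^sup>2)"

definition cstar_positive :: "('a::{real_normed_algebra_1,banach} \<Rightarrow> 'a) \<Rightarrow> 'a \<Rightarrow> bool" where
  "cstar_positive st a \<longleftrightarrow> (\<exists>b. a = st b * b)"

definition star_automorphism ::
  "(complex \<Rightarrow> 'a::{real_normed_algebra_1,banach} \<Rightarrow> 'a) \<Rightarrow> ('a \<Rightarrow> 'a) \<Rightarrow> ('a \<Rightarrow> 'a) \<Rightarrow> bool" where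
  "star_automorphism sm st f \<longleftrightarrow>
     bij f \<and>
     (\<forall>a b. f (a + b) = f a + f b) \<and>
     (\<forall>c a. f (sm c a) = sm c (f a)) \<and>
     (\<forall>a b. f (a * b) = f a * f b) \<and>
     f 1 = 1 \<and>
     (\<forall>a. f (st a) = st (f a))"

text \<open>A compact (Hausdorff) topological group, written additively (group_add is not
assumed commutative); the identity is 0.\<close>

definition compact_group :: "'g::{t2_space,group_add} itself \<Rightarrow> bool" where
  "compact_group _ \<longleftrightarrow> compact (UNIV :: 'g set) \<and>
     continuous_on UNIV (\<lambda>p::'g \<times> 'g. fst p + snd p) \<and>
     continuous_on UNIV (\<lambda>x::'g. - x)"

definition ergodic_strongly_continuous_action ::
  "(complex \<Rightarrow> 'a::{real_normed_algebra_1,banach} \<Rightarrow> 'a) \<Rightarrow> ('a \<Rightarrow> 'a) \<Rightarrow>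
   ('g::{t2_space,group_add} \<Rightarrow> 'a \<Rightarrow> 'a) \<Rightarrow> bool" where
  "ergodic_strongly_continuous_action sm st \<alpha> \<longleftrightarrow>
     (\<forall>x. star_automorphism sm st (\<alpha> x)) \<and>
     \<alpha> 0 = id \<and>
     (\<forall>x y. \<alpha> (x + y) = \<alpha> x \<circ> \<alpha> y) \<and>
     (\<forall>a. continuous_on UNIV (\<lambda>x. \<alpha> x a)) \<and>
     {a. \<forall>x. \<alpha> x a = a} = {sm c 1 | c. True}"

definition continuous_length_function :: "('g::{t2_space,group_add} \<Rightarrow> real) \<Rightarrow> bool" where
  "continuous_length_function l \<longleftrightarrow>
     continuous_on UNIV l \<and>
     (\<forall>x. l x \<ge> 0) \<and>
     (\<forall>x y. l (x + y) \<le> l x + l y) \<and>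
     (\<forall>x. l (- x) = l x) \<and>
     (\<forall>x. l x = 0 \<longleftrightarrow> x = 0)"

text \<open>The seminorm L(a) = sup { norm (alpha_x a - a) / l x : x \<noteq> e } (value \<infinity> allowed);
the empty supremum (trivial group) is taken to be 0.\<close>

definition lip_seminorm ::
  "('g::{t2_space,group_add} \<Rightarrow> 'a::{real_normed_algebra_1,banach} \<Rightarrow> 'a) \<Rightarrow> ('g \<Rightarrow> real) \<Rightarrow> 'a \<Rightarrow> ereal" where
  "lip_seminorm \<alpha> l a = Sup ({0} \<union> (\<lambda>x. ereal (norm (\<alpha> x a - a) / l x)) ` {x. x \<noteq> 0})"

text \<open>The order-unit space D (a real subspace of self-adjoint elements containing 1, with
the order of the C*-algebra). States are extensional functions on D.\<close>

definition order_unit_subspace ::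
  "('a::{real_normed_algebra_1,banach} \<Rightarrow> 'a) \<Rightarrow> 'a set \<Rightarrow> bool" where
  "order_unit_subspace st D \<longleftrightarrow> 1 \<in> D \<and> (\<forall>a\<in>D. st a = a) \<and>
     (\<forall>a\<in>D. \<forall>b\<in>D. a + b \<in> D) \<and> (\<forall>r. \<forall>a\<in>D. r *\<^sub>R a \<in> D)"

definition state_space ::
  "('a::{real_normed_algebra_1,banach} \<Rightarrow> 'a) \<Rightarrow> 'a set \<Rightarrow> ('a \<Rightarrow> real) set" where
  "state_space st D = {\<mu>. \<mu> \<in> extensional D \<and>
     (\<forall>a\<in>D. \<forall>b\<in>D. \<mu> (a + b) = \<mu> a + \<mu> b) \<and>
     (\<forall>r. \<forall>a\<in>D. \<mu> (r *\<^sub>R a) = r * \<mu> a) \<and>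
     (\<forall>a\<in>D. cstar_positive st a \<longrightarrow> \<mu> a \<ge> 0) \<and>
     \<mu> 1 = 1}"

definition weak_star_topology ::
  "('a::{real_normed_algebra_1,banach} \<Rightarrow> 'a) \<Rightarrow> 'a set \<Rightarrow> ('a \<Rightarrow> real) topology" where
  "weak_star_topology st D =
     subtopology (product_topology (\<lambda>_. euclideanreal) D) (state_space st D)"

definition rho_L :: "'a set \<Rightarrow> ('a \<Rightarrow> ereal) \<Rightarrow> ('a \<Rightarrow> real) \<Rightarrow> ('a \<Rightarrow> real) \<Rightarrow> ereal" where
  "rho_L D L \<mu> \<nu> = Sup ((\<lambda>a. ereal \<bar>\<mu> a - \<nu> a\<bar>) ` {a\<in>D. L a \<le> 1})"

definition metric_topology_on :: "'s set \<Rightarrow> ('s \<Rightarrow> 's \<Rightarrow> ereal) \<Rightarrow> 's topology" where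
  "metric_topology_on S d =
     topology (\<lambda>U. U \<subseteq> S \<and> (\<forall>x\<in>U. \<exists>r>0. {y\<in>S. d x y < ereal r} \<subseteq> U))"

definition lip_norm ::
  "('a::{real_normed_algebra_1,banach} \<Rightarrow> 'a) \<Rightarrow> 'a set \<Rightarrow> ('a \<Rightarrow> ereal) \<Rightarrow> bool" where
  "lip_norm st D L \<longleftrightarrow>
     order_unit_subspace st D \<and>
     (\<forall>a\<in>D. L a \<noteq> \<infinity> \<and> L a \<noteq> - \<infinity>) \<and>
     (\<forall>a\<in>D. \<forall>b\<in>D. L (a + b) \<le> L a + L b) \<and>
     (\<forall>r. \<forall>a\<in>D. L (r *\<^sub>R a) = ereal \<bar>r\<bar> * L a) \<and>
     L 1 = 0 \<and>
     metric_topology_on (state_space st D) (rho_L D L) = weak_star_topology st D"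

end

theory Submission
  imports Defs "HOL-Real_Asymp.Real_Asymp"
begin

text \<open>For \<open>\<epsilon> > 0\<close>, averaging over the part of the group where the length is less than \<open>\<epsilon>\<close> moves every \<open>a\<close> with
  \<open>L(a) \<le> 1\<close> by at most \<open>\<epsilon>\<close>, so it suffices to see that such local averages are compact.
  Neither Haar measure nor the Peter--Weyl theorem is needed: by ergodicity, finite means of orbits
  approximate \<open>\<phi>(a) 1\<close> for an invariant state \<open>\<phi>\<close>, and for elements \<open>e\<^sub>k\<close> orthonormal
  with respect to \<open>\<phi>\<close> the functions \<open>x \<mapsto> \<alpha>\<^sub>x(e\<^sub>k)\<close> are orthonormal in the Hilbert module of
  \<open>A\<close>-valued functions on \<open>G\<close>, because \<open>\<alpha>\<^sub>x(e\<^sub>j\<^sup>* e\<^sub>k)\<close> has a scalar mean. Bessel's inequality, tested against an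
  indicator function near the identity, shows that the local average \<open>T\<close> is Hilbert-Schmidt:
  \<open>\<Sum>\<^sub>k \<phi>(T(e\<^sub>k) T(e\<^sub>k)\<^sup>*)\<close> is bounded independently of the family. Its rank one case bounds the norm of
  \<open>T(a)\<close> by the \<open>\<phi>\<close>-seminorm of \<open>a\<close>. Hence the Lipschitz ball is totally bounded in norm modulo scalars,
  which makes the \<open>\<rho>\<^sub>L\<close>-balls weak-* neighbourhoods.\<close>

section \<open>Square roots and positivity in a C*-algebra\<close>

text \<open>Positivity is handled through a norm predicate \<open>pos\<close>. That every
  \<open>st b * b\<close> satisfies it is a theorem here, obtained from square roots and power
  estimates in place of functional calculus; the inner product of \<open>phi\<close> and the
  variance inequality rest on it. As means run over finite lists, there is no single averaging
  operator \<open>T\<close>: the list depends on the finitely many elements that it has to treat and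
  on a tolerance. What stays fixed is a constant \<open>N\<close>, determined by the radius alone,
  which bounds the ratio of the length of a list to that of its part near the identity. All
  estimates are phrased with \<open>N\<close>, and lists are chosen anew each time. Since
  \<open>phi\<close> is not known to be a trace, \<open>nsq c\<close> and \<open>nsq (st c)\<close>
  have to be kept apart. Bessel's inequality bounds the seminorm of the adjoint of
  \<open>T e\<close>, and the norm of a local mean of \<open>c\<close> is bounded by
  \<open>nsq (st c)\<close>, so applying two local means in succession makes the estimates fit
  together.\<close>

locale cstar =
  fixes sm :: "complex \<Rightarrow> 'a::{real_normed_algebra_1,banach} \<Rightarrow> 'a" and st :: "'a \<Rightarrow> 'a"
  assumes cstar: "unital_cstar_algebra sm st"
begin

lemma sm_of_real: "sm (of_real r) a = r *\<^sub>R a"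
  and sm_1: "sm 1 a = a"
  and sm_sm: "sm c (sm d a) = sm (c * d) a"
  and sm_add_left: "sm (c + d) a = sm c a + sm d a"
  and sm_add_right: "sm c (a + b) = sm c a + sm c b"
  and mult_sm_left: "sm c a * b = sm c (a * b)"
  and mult_sm_right: "a * sm c b = sm c (a * b)"
  and norm_sm: "norm (sm c a) = cmod c * norm a"
  and st_add: "st (a + b) = st a + st b"
  and st_sm: "st (sm c a) = sm (cnj c) (st a)"
  and st_st: "st (st a) = a"
  and st_mult: "st (a * b) = st b * st a"
  and norm_st_mult: "norm (st a * a) = (norm a)\<^sup>2"
  using cstar unfolding unital_cstar_algebra_def by metis+

lemma sm_scaleR: "sm c (r *\<^sub>R a) = r *\<^sub>R sm c a"
  by (metis mult.commute sm_of_real sm_sm)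

lemma sm_linear: "linear (sm c)"
  by (rule linearI) (simp_all add: sm_add_right sm_scaleR)

lemmas sm_diff_right = linear_diff[OF sm_linear]

lemma sm_diff_left: "sm (c - d) a = sm c a - sm d a"
  using sm_add_left[of "c - d" d a] by (simp add: algebra_simps)

lemma sm_minus_left: "sm (- c) a = - sm c a"
  using sm_diff_left[of 0 c a] sm_of_real[of 0 a] by simp

lemma st_scaleR: "st (r *\<^sub>R a) = r *\<^sub>R st a"
  by (metis complex_cnj_complex_of_real sm_of_real st_sm)

lemma st_linear: "linear st"
  by (rule linearI) (simp_all add: st_add st_scaleR)

lemmas st_diff = linear_diff[OF st_linear]
  and st_sum = linear_sum[OF st_linear]
  and st_0 [simp] = linear_0[OF st_linear]
  and st_minus = linear_neg[OF st_linear]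

lemma st_1 [simp]: "st 1 = 1"
  by (metis mult.right_neutral mult.left_neutral st_mult st_st)

lemma st_of_real [simp]: "st (of_real r) = of_real r"
  by (simp add: of_real_def st_scaleR)

lemma st_power: "st (a ^ n) = st a ^ n"
  by (induction n) (simp_all add: st_mult power_commutes)

lemma norm_st [simp]: "norm (st a) = norm a"
proof -
  have le: "norm a \<le> norm (st a)" for a
  proof (cases "norm a = 0")
    case False
    have "(norm a)\<^sup>2 \<le> norm (st a) * norm a"
      by (metis norm_mult_ineq norm_st_mult)
    then show ?thesis using False
      by (simp add: power2_eq_square)
  qed simp
  show ?thesis using le[of a] le[of "st a"] by (simp add: st_st)
qed

lemma norm_mult_st: "norm (a * st a) = (norm a)\<^sup>2"
  by (metis norm_st norm_st_mult st_st)

lemma norm_square_sa: "st h = h \<Longrightarrow> norm (h * h) = (norm h)\<^sup>2"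
  by (metis norm_st_mult)

lemma continuous_on_st: "continuous_on S st"
proof -
  have "bounded_linear st"
    by (rule bounded_linear_intro[where K = 1]) (simp_all add: st_add st_scaleR)
  then show ?thesis by (simp add: linear_continuous_on)
qed

text \<open>Double commutant relation, a substitute for \<open>s\<close> lying in the closed algebra
  generated by \<open>h\<close>. It makes roots of \<open>t - h\<close> and \<open>t + h\<close>
  commute with each other and with \<open>h\<close>.\<close>

definition bicommutes :: "'a \<Rightarrow> 'a \<Rightarrow> bool" where
  "bicommutes h s \<longleftrightarrow> (\<forall>z. z * h = h * z \<longrightarrow> z * s = s * z)"

lemma bicommutesI: "(\<And>z. z * h = h * z \<Longrightarrow> z * s = s * z) \<Longrightarrow> bicommutes h s"
  and bicommutesD: "bicommutes h s \<Longrightarrow> z * h = h * z \<Longrightarrow> z * s = s * z"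
  by (auto simp: bicommutes_def)

lemma bicommutes_of_real_diff: "bicommutes (of_real t - h) s \<longleftrightarrow> bicommutes h s"
  by (simp add: bicommutes_def left_diff_distrib right_diff_distrib of_real_def)

lemma bicommutes_of_real_add: "bicommutes (of_real t + h) s \<longleftrightarrow> bicommutes h s"
  by (simp add: bicommutes_def distrib_left distrib_right of_real_def)

text \<open>Writing \<open>s = 1 - y\<close>, the equation \<open>s * s = 1 - h\<close> says that \<open>y\<close> is a fixed point of
  \<open>y \<mapsto> (h + y * y) / 2\<close>, a contraction of a small closed ball.\<close>

lemma sqrt_exists:
  assumes h: "st h = h" "norm h < 1"
  obtains s where "st s = s" "s * s = 1 - h" "bicommutes h s"
proof -
  \<comment> \<open>The smaller solution of \<open>norm h + r * r = 2 * r\<close>: \<open>f\<close>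
    maps the ball of radius \<open>r\<close> into itself, and \<open>r < 1\<close> is its
    contraction constant.\<close>
  define r where "r = 1 - sqrt (1 - norm h)"
  have r: "0 \<le> r" "r < 1" and rr: "norm h + r * r = 2 * r"
    using h(2) by (auto simp: r_def algebra_simps)
  define f where "f y = (1/2) *\<^sub>R (h + y * y)" for y
  define S where "S = cball 0 r \<inter> {y. st y = y} \<inter> (\<Inter>z\<in>{z. z * h = h * z}. {y. z * y = y * z})"
  have SI: "y \<in> S \<longleftrightarrow> norm y \<le> r \<and> st y = y \<and> bicommutes h y" for y
    by (auto simp: S_def bicommutes_def)
  have "closed S" unfolding S_def
    by (intro closed_Int closed_INT ballI closed_cball closed_Collect_eq continuous_intros continuous_on_st)
  then have "complete S" by (simp add: complete_eq_closed)
  moreover have "0 \<in> S" using r by (auto simp: SI bicommutes_def)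
  moreover have "f ` S \<subseteq> S"
  proof (rule image_subsetI)
    fix y assume y: "y \<in> S"
    have "norm (y * y) \<le> r * r"
      using y by (intro order_trans[OF norm_mult_ineq] mult_mono) (use r in \<open>auto simp: SI\<close>)
    then have "norm (h + y * y) \<le> 2 * r"
      using norm_triangle_ineq[of h "y * y"] rr by linarith
    then have "norm (f y) \<le> r"
      unfolding f_def by simp
    moreover have "st (f y) = f y"
      using y h by (simp add: SI f_def st_scaleR st_add st_mult)
    moreover have "bicommutes h (f y)"
    proof (rule bicommutesI)
      fix z assume z: "z * h = h * z"
      have "z * y = y * z" using z y by (auto simp: SI dest: bicommutesD)
      then have "z * (y * y) = (y * y) * z" by (metis mult.assoc)
      with z show "z * f y = f y * z" by (simp add: f_def distrib_left distrib_right)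
    qed
    ultimately show "f y \<in> S" by (simp add: SI)
  qed
  moreover have "dist (f x) (f y) \<le> r * dist x y" if xy: "x \<in> S" "y \<in> S" for x y
  proof -
    have "f x - f y = (1/2) *\<^sub>R (x * (x - y) + (x - y) * y)"
      by (simp add: f_def algebra_simps)
    then have "norm (f x - f y) \<le> (1/2) * (norm (x * (x - y)) + norm ((x - y) * y))"
      by (simp add: norm_triangle_ineq)
    also have "\<dots> \<le> (1/2) * (r * norm (x - y) + norm (x - y) * r)"
      using xy by (intro mult_left_mono add_mono order_trans[OF norm_mult_ineq] mult_mono) (use r in \<open>auto simp: SI\<close>)
    finally show "dist (f x) (f y) \<le> r * dist x y" by (simp add: dist_norm)
  qed
  ultimately obtain y where y: "y \<in> S" "f y = y"
    using Banach_fix[of S r f] r by auto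
  have "h + y * y = 2 *\<^sub>R y"
    using arg_cong[OF y(2), of "\<lambda>v. 2 *\<^sub>R v"] by (simp add: f_def)
  then have "(1 - y) * (1 - y) = 1 - h"
    by (simp add: algebra_simps scaleR_2)
  moreover have "st (1 - y) = 1 - y" using y by (simp add: SI st_diff)
  moreover have "bicommutes h (1 - y)"
    using y by (auto simp: SI bicommutes_def left_diff_distrib right_diff_distrib)
  ultimately show thesis using that by blast
qed

text \<open>By commutation \<open>u = h + i y\<close> satisfies \<open>st u * u = t^2\<close>, so
  the C*-identity gives \<open>norm u = t\<close>, and \<open>h\<close> is the real part of
  \<open>u\<close>.\<close>

lemma norm_sq_le_of_sum_squares:
  assumes "st h = h" "st y = y" "h * y = y * h" "h * h + y * y = of_real (t\<^sup>2)" "0 \<le> t"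
  shows "norm h \<le> t"
proof -
  define u where "u = h + sm \<i> y"
  have su: "st u = h - sm \<i> y"
    using assms by (simp add: u_def st_add st_sm sm_minus_left)
  have "st u * u = h * h + y * y"
    unfolding su using assms(3)
    by (simp add: u_def ring_distribs mult_sm_left mult_sm_right sm_sm sm_minus_left sm_1 sm_diff_right sm_add_right)
  then have "(norm u)\<^sup>2 = t\<^sup>2"
    using assms(4) norm_st_mult[of u] by (metis abs_power2 norm_of_real)
  then have "norm u = t" using assms(5) by (simp add: power2_eq_iff_nonneg)
  moreover have "h = (1/2) *\<^sub>R (u + st u)"
    unfolding su by (simp add: u_def flip: scaleR_2)
  then have "norm h \<le> (1/2) * (norm u + norm (st u))"
    by (metis norm_scaleR norm_triangle_ineq abs_of_nonneg mult_left_mono zero_le_divide_1_iff zero_le_numeral)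
  ultimately show ?thesis by simp
qed

text \<open>Norm form of having spectrum in \<open>[0, 2 t]\<close>. Sums and nonnegative multiples
  are then a matter of the triangle inequality; a negative \<open>t\<close> is excluded by the
  norm.\<close>

definition pos :: "'a \<Rightarrow> bool" where
  "pos h \<longleftrightarrow> st h = h \<and> (\<exists>t. norm (of_real t - h) \<le> t)"

lemma posI: "st h = h \<Longrightarrow> norm (of_real t - h) \<le> t \<Longrightarrow> pos h"
  by (auto simp: pos_def)

lemma pos_sa: "pos h \<Longrightarrow> st h = h"
  by (simp add: pos_def)

lemma sqrt_near:
  assumes "st h = h" "norm (of_real t - h) < t"
  obtains s where "st s = s" "s * s = h" "bicommutes h s"
proof -
  have t: "t > 0" using assms(2) norm_ge_zero le_less_trans by blast
  define k where "k = (1/t) *\<^sub>R (of_real t - h)"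
  have "st k = k" "norm k < 1"
    using assms t by (simp_all add: k_def st_scaleR st_diff)
  then obtain s where s: "st s = s" "s * s = 1 - k" "bicommutes k s"
    by (rule sqrt_exists) blast
  have kh: "t *\<^sub>R (1 - k) = h"
    using t by (simp add: k_def algebra_simps of_real_def)
  show thesis
  proof (rule that[of "sqrt t *\<^sub>R s"])
    show "sqrt t *\<^sub>R s * sqrt t *\<^sub>R s = h"
      using s(2) t kh by simp
    show "bicommutes h (sqrt t *\<^sub>R s)"
    proof (rule bicommutesI)
      fix z assume "z * h = h * z"
      then have "z * k = k * z"
        by (simp add: k_def left_diff_distrib right_diff_distrib of_real_def)
      then show "z * sqrt t *\<^sub>R s = sqrt t *\<^sub>R s * z"
        using bicommutesD[OF s(3)] by simp
    qed
  qed (simp add: st_scaleR s(1))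
qed

text \<open>Strictness provides a root \<open>r\<close> of \<open>t - s * s\<close>. Then
  \<open>r * r + s * s = t\<close> with commuting \<open>r\<close> and \<open>s\<close>, so
  \<open>norm r \<le> sqrt t\<close>, and the norm in question is the square of
  \<open>norm r\<close>.\<close>

lemma norm_diff_square:
  assumes "st s = s" "(norm s)\<^sup>2 < t"
  shows "norm (of_real t - s * s) \<le> t"
proof -
  have t: "t > 0" using assms(2) zero_le_power2 le_less_trans by blast
  have "norm (of_real t - (of_real t - s * s)) < t"
    using assms by (simp add: norm_square_sa)
  then obtain r where r: "st r = r" "r * r = of_real t - s * s" "bicommutes (s * s) r"
    by (rule sqrt_near[rotated]) (auto simp: assms st_diff st_mult bicommutes_of_real_diff)
  have "s * r = r * s"
    by (rule bicommutesD[OF r(3)]) (simp add: mult.assoc)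
  then have "norm r \<le> sqrt t"
    using assms r t by (intro norm_sq_le_of_sum_squares[of r s]) auto
  then have "(norm r)\<^sup>2 \<le> t"
    using t by (metis norm_ge_zero power_mono real_sqrt_pow2 less_imp_le)
  then show ?thesis using r by (metis norm_square_sa)
qed

lemma pos_square: "st s = s \<Longrightarrow> pos (s * s)"
  by (rule posI[OF _ norm_diff_square[of s "(norm s)\<^sup>2 + 1"]]) (auto simp: st_mult)

lemma pos_add:
  assumes "pos a" "pos b" shows "pos (a + b)"
proof -
  obtain t t' where "norm (of_real t - a) \<le> t" "norm (of_real t' - b) \<le> t'"
    using assms by (auto simp: pos_def)
  then have "norm (of_real (t + t') - (a + b)) \<le> t + t'"
    using norm_triangle_ineq[of "of_real t - a" "of_real t' - b"]
    by (simp add: algebra_simps)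
  then show ?thesis using assms by (intro posI[of _ "t + t'"]) (auto simp: st_add pos_sa)
qed

lemma pos_of_real: "0 \<le> r \<Longrightarrow> pos (of_real r)"
  unfolding pos_def by (auto intro!: exI[of _ r])

lemma pos_of_realD:
  assumes "pos (of_real r)" shows "0 \<le> r"
proof -
  obtain t where "norm (of_real (t - r) :: 'a) \<le> t"
    using assms by (auto simp: pos_def)
  then show ?thesis unfolding norm_of_real by simp
qed

lemma pos_0 [simp]: "pos 0"
  using pos_of_real[of 0] by simp

lemma pos_scaleR:
  assumes "pos a" "0 \<le> r" shows "pos (r *\<^sub>R a)"
proof -
  obtain t where "norm (of_real t - a) \<le> t"
    using assms by (auto simp: pos_def)
  then have "norm (r *\<^sub>R (of_real t - a)) \<le> r * t"
    using assms(2) by (simp add: mult_left_mono)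
  then have "norm (of_real (r * t) - r *\<^sub>R a) \<le> r * t"
    by (simp add: algebra_simps of_real_def)
  then show ?thesis using assms by (intro posI[of _ "r * t"]) (auto simp: st_scaleR pos_sa)
qed

lemma pos_sum: "(\<And>i. i \<in> I \<Longrightarrow> pos (f i)) \<Longrightarrow> pos (\<Sum>i\<in>I. f i)"
  by (induction I rule: infinite_finite_induct) (auto intro: pos_add)

text \<open>Roots come from a contraction and so require a strict inequality, which the shift by
  \<open>e\<close> creates. Later arguments recover the limit case by letting \<open>e\<close> tend
  to 0.\<close>

lemma pos_sqrt_strict:
  assumes "pos h" "e > 0"
  obtains s where "st s = s" "s * s = h + of_real e" "bicommutes h s"
proof -
  obtain t where t: "norm (of_real t - h) \<le> t"
    using assms by (auto simp: pos_def)
  have "norm (of_real (t + e) - (h + of_real e)) < t + e"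
    using t assms(2) by simp
  then show thesis
    by (rule sqrt_near[rotated])
      (use assms that in \<open>auto simp: st_add pos_sa bicommutes_of_real_add add.commute[of h]\<close>)
qed

text \<open>The witness in \<open>pos\<close> can be any \<open>t\<close> that is at least
  \<open>norm h\<close>. This uniform choice is what lets \<open>pos\<close> survive the limit in
  \<open>pos_approx\<close>.\<close>

lemma pos_norm_diff:
  assumes "pos h" "norm h \<le> t" shows "norm (of_real t - h) \<le> t"
proof (rule field_le_epsilon)
  fix e :: real assume e: "e > 0"
  obtain s where s: "st s = s" "s * s = h + of_real (e/4)"
    using pos_sqrt_strict[of h "e/4"] assms e by auto
  have "(norm s)\<^sup>2 \<le> norm h + e/4"
    using norm_triangle_ineq[of h "of_real (e/4)"] norm_square_sa[OF s(1)] s(2) e by simp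
  then have "norm (of_real (t + e/2) - s * s) \<le> t + e/2"
    using assms e s by (intro norm_diff_square) auto
  moreover have "norm (of_real (e/4) :: 'a) \<le> e/2"
    using e unfolding norm_of_real by simp
  moreover have "of_real t - h = (of_real (t + e/2) - s * s) - of_real (e/4)"
    unfolding s by (simp add: algebra_simps flip: of_real_add)
  ultimately show "norm (of_real t - h) \<le> t + e"
    by (metis norm_triangle_le_diff add_mono field_sum_of_halves add.assoc)
qed

lemma pos_approx:
  assumes "\<And>e. e > 0 \<Longrightarrow> pos (h + of_real e)" shows "pos h"
proof -
  have "st (h + of_real 1) = h + of_real 1"
    by (intro pos_sa assms) simp
  then have "st h = h" by (simp add: st_add)
  moreover have "norm (of_real (norm h) - h) \<le> norm h"
  proof (rule field_le_epsilon)
    fix e :: real assume e: "e > 0"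
    have "norm (of_real (norm h + e) - (h + of_real e)) \<le> norm h + e"
      using e norm_triangle_ineq[of h "of_real e"] by (intro pos_norm_diff assms) auto
    then show "norm (of_real (norm h) - h) \<le> norm h + e" by simp
  qed
  ultimately show ?thesis by (rule posI)
qed

lemma pos_of_norm_le: "st h = h \<Longrightarrow> norm h \<le> t \<Longrightarrow> pos (of_real t - h)"
  unfolding pos_def by (auto intro!: exI[of _ t] simp: st_diff)

text \<open>The roots \<open>a\<close>, \<open>b\<close> of \<open>t + e - h\<close> and
  \<open>t + e + h\<close> commute with each other and with \<open>h\<close>, and
  \<open>(a b)^2 + h^2 = (t + e)^2\<close>; the bound for commuting sums of squares applies.\<close>

lemma norm_le_of_pos:
  assumes "pos (of_real t - h)" "pos (of_real t + h)" 
  shows "norm h \<le> t"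
proof -
  have "of_real t - h + (of_real t + h) = of_real (2 * t)"
    by (metis add.commute add_diff_cancel_left' diff_add_cancel add.assoc mult_2 of_real_add)
  then have "pos (of_real (2 * t))"
    using pos_add[OF assms] by simp
  then have t: "0 \<le> t" using pos_of_realD by fastforce
  have h: "st h = h" using pos_sa[OF assms(2)] by (simp add: st_add)
  show ?thesis
  proof (rule field_le_epsilon)
    fix e :: real assume e: "e > 0"
    obtain a where a: "st a = a" "a * a = of_real t - h + of_real e" "bicommutes h a"
      using pos_sqrt_strict[OF assms(1) e] by (auto simp: bicommutes_of_real_diff)
    obtain b where b: "st b = b" "b * b = of_real t + h + of_real e" "bicommutes h b"
      using pos_sqrt_strict[OF assms(2) e] by (auto simp: bicommutes_of_real_add)
    have ha: "h * a = a * h" by (rule bicommutesD[OF a(3)]) simp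
    have hb: "h * b = b * h" by (rule bicommutesD[OF b(3)]) simp
    have ab: "a * b = b * a" using ha by (intro bicommutesD[OF b(3)]) simp
    have "(a * b) * (a * b) = (a * a) * (b * b)" by (metis ab mult.assoc)
    also have "\<dots> = of_real ((t + e)\<^sup>2) - h * h"
      unfolding a b by (simp add: algebra_simps of_real_def power2_eq_square) (simp flip: scaleR_left_distrib)
    finally show "norm h \<le> t + e"
      using h t e a b ab ha hb
      by (intro norm_sq_le_of_sum_squares[of h "a * b"]) (auto simp: st_mult, metis mult.assoc)
  qed
qed


section \<open>Positivity of \<open>st b * b\<close>\<close>

lemma st_mult_add_pos: "pos (st c * c + c * st c)"
proof -
  define p q where "p = c + st c" and "q = sm \<i> (c - st c)"
  have p: "st p = p" by (simp add: p_def st_add st_st)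
  have q: "st q = q" by (simp add: q_def st_sm st_diff st_st sm_minus_left sm_diff_right)
  have "q * q = - ((c - st c) * (c - st c))"
    by (simp add: q_def mult_sm_left mult_sm_right sm_sm sm_minus_left sm_1)
  then have "p * p + q * q = 2 *\<^sub>R (st c * c + c * st c)"
    by (simp add: p_def algebra_simps scaleR_2)
  then have "st c * c + c * st c = (1/2) *\<^sub>R (p * p + q * q)" by simp
  also have "pos \<dots>"
    by (intro pos_scaleR pos_add pos_square p q) simp
  finally show ?thesis .
qed

lemma norm_power_sa: "st a = a \<Longrightarrow> norm (a ^ (2 ^ m)) = norm a ^ (2 ^ m)"
proof (induction m)
  case (Suc m)
  have "a ^ (2 ^ Suc m) = a ^ (2 ^ m) * a ^ (2 ^ m)"
    by (simp add: mult_2 power_add)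
  then show ?case
    using Suc norm_square_sa[of "a ^ (2 ^ m)"]
    by (simp add: st_power power_mult power2_eq_square mult_2 power_add)
qed simp

text \<open>Stands in for the spectral radius formula: on self-adjoint elements the norm commutes
  with dyadic powers (\<open>norm_power_sa\<close>), so linear growth of the powers already forces
  norm at most 1.\<close>

lemma linear_growth_imp_le_1:
  fixes x c d :: real
  assumes "\<And>m. x ^ (2 ^ m) \<le> c + d * 2 ^ m" "0 \<le> x"
  shows "x \<le> 1"
proof (rule ccontr)
  assume "\<not> x \<le> 1"
  then have x: "x > 1" by simp
  have "(\<lambda>n::nat. (c + d * real n) / x ^ n) \<longlonglongrightarrow> 0"
    using x by real_asymp
  moreover have "filterlim (\<lambda>m::nat. (2::nat) ^ m) at_top sequentially"
    by real_asymp
  ultimately have "((\<lambda>n::nat. (c + d * real n) / x ^ n) \<circ> (\<lambda>m. 2 ^ m)) \<longlonglongrightarrow> 0"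
    unfolding comp_def by (rule filterlim_compose)
  then have "\<forall>\<^sub>F m in sequentially. (c + d * real (2 ^ m)) / x ^ (2 ^ m) < 1"
    unfolding comp_def by (rule order_tendstoD(2)) simp
  then obtain m where "(c + d * real (2 ^ m)) / x ^ (2 ^ m) < 1"
    using eventually_happens by fastforce
  then have "c + d * real (2 ^ m) < x ^ (2 ^ m)" using x by simp
  with assms(1)[of m] show False by simp
qed

text \<open>The two elements have the same spectrum up to \<open>0\<close>. Here \<open>c * st c * p (c * st c)
  = c * p (st c * c) * st c\<close> for the polynomials \<open>p = (t + X) ^ n\<close> replaces spectral theory.\<close>

lemma norm_add_mult_st:
  assumes "norm (of_real t + st c * c) \<le> r" "\<bar>t\<bar> \<le> r"
  shows "norm (of_real t + c * st c) \<le> r"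
proof (cases "r = 0")
  case True
  then have "t = 0" "norm (st c * c) = 0" using assms by auto
  then show ?thesis by (simp only: norm_mult_st norm_st_mult) (use True in simp)
next
  case False
  then have r: "r > 0" using assms by linarith
  define h k where "h = of_real t + st c * c" and "k = of_real t + c * st c"
  have hk: "c * h ^ n = k ^ n * c" for n
  proof (induction n)
    case (Suc n)
    have "c * h = k * c" by (simp add: h_def k_def distrib_left distrib_right mult.assoc of_real_def)
    then show ?case using Suc by (metis mult.assoc power_Suc2 power_Suc)
  qed simp
  have bound: "norm (k ^ n) \<le> r ^ n + real n * ((norm c)\<^sup>2 / r) * r ^ n" for n
  proof (induction n)
    case (Suc n)
    have "k ^ Suc n = t *\<^sub>R k ^ n + k ^ n * c * st c"
      by (simp add: power_Suc2 k_def distrib_left distrib_right of_real_def mult.assoc del: power_Suc)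
    also have "k ^ n * c * st c = c * h ^ n * st c" by (simp add: hk)
    finally have eq: "k ^ Suc n = t *\<^sub>R k ^ n + c * h ^ n * st c" .
    have "norm (c * h ^ n * st c) \<le> norm c * norm (h ^ n) * norm c"
      using norm_mult_ineq[of "c * h ^ n" "st c"] mult_right_mono[OF norm_mult_ineq[of c "h ^ n"], of "norm c"]
      by simp
    also have "\<dots> \<le> norm c * r ^ n * norm c"
      using assms(1) by (intro mult_left_mono mult_right_mono order_trans[OF norm_power_ineq] power_mono)
        (auto simp: h_def)
    finally have "norm (k ^ Suc n) \<le> \<bar>t\<bar> * norm (k ^ n) + (norm c)\<^sup>2 * r ^ n"
      unfolding eq using norm_triangle_ineq[of "t *\<^sub>R k ^ n" "c * h ^ n * st c"]
      by (simp add: power2_eq_square mult_ac)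
    also have "\<bar>t\<bar> * norm (k ^ n) \<le> r * (r ^ n + real n * ((norm c)\<^sup>2 / r) * r ^ n)"
      using Suc assms(2) r by (intro mult_mono) auto
    finally show ?case using r by (simp add: field_simps)
  qed simp
  have sk: "st k = k" by (simp add: k_def st_add st_mult st_st)
  have "norm k / r \<le> 1"
  proof (rule linear_growth_imp_le_1)
    fix m :: nat
    have "norm k ^ (2 ^ m) = norm (k ^ (2 ^ m))" by (simp add: norm_power_sa sk)
    also have "\<dots> \<le> (1 + ((norm c)\<^sup>2 / r) * 2 ^ m) * r ^ (2 ^ m)"
      using bound[of "2 ^ m"] by (simp add: algebra_simps)
    finally show "(norm k / r) ^ (2 ^ m) \<le> 1 + ((norm c)\<^sup>2 / r) * 2 ^ m"
      using r by (simp add: power_divide field_simps)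
  qed (use r in simp)
  then show ?thesis using r by (simp add: k_def)
qed

text \<open>Positivity of \<open>st c * c\<close> is not yet available. If
  \<open>r = (norm c)^2\<close> exceeded \<open>M\<close>, the bound
  \<open>norm (r + st c * c) \<le> r + M\<close> would carry over to \<open>c * st c\<close> and
  give \<open>c * st c \<le> M\<close>, while \<open>st_mult_add_pos\<close> gives
  \<open>- M \<le> - (st c * c) \<le> c * st c\<close>. Hence
  \<open>norm (c * st c) \<le> M < r\<close>, a contradiction.\<close>

lemma norm_st_mult_le:
  assumes "pos (of_real M - st c * c)" "0 \<le> M"
  shows "(norm c)\<^sup>2 \<le> M"
proof (rule ccontr)
  assume "\<not> (norm c)\<^sup>2 \<le> M"
  define r where "r = (norm c)\<^sup>2"
  have r: "M < r" "0 \<le> r" using \<open>\<not> _\<close> by (simp_all add: r_def)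
  have h: "pos (of_real r + st c * c)"
    using pos_of_norm_le[of "- (st c * c)" r] by (simp add: st_minus st_mult st_st norm_st_mult r_def)
  have "norm (of_real r + st c * c) \<le> r + M"
  proof (rule norm_le_of_pos)
    show "pos (of_real (r + M) - (of_real r + st c * c))" using assms by simp
    show "pos (of_real (r + M) + (of_real r + st c * c))"
      using pos_add[OF pos_of_real[of "r + M"] h] r assms by simp
  qed
  then have "norm (of_real r + c * st c) \<le> r + M"
    using r assms by (intro norm_add_mult_st) auto
  then have "pos (of_real (r + M) - (of_real r + c * st c))"
    by (intro pos_of_norm_le) (simp_all add: st_add st_mult st_st)
  then have "pos (of_real M - c * st c)" by simp
  moreover have "pos (of_real M + c * st c)"
    using pos_add[OF assms(1) st_mult_add_pos[of c]] by (simp add: algebra_simps)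
  ultimately have "norm (c * st c) \<le> M" by (rule norm_le_of_pos)
  then show False using r by (simp add: norm_mult_st r_def)
qed

text \<open>For \<open>x \<ge> 0\<close> all terms on the right are nonnegative, so this is the
  algebraic form of the estimate \<open>(1 - x) x^m \<le> 1 / m\<close>.\<close>

lemma power_sos:
  fixes x :: "'b::real_normed_algebra_1"
  shows "1 - real m *\<^sub>R ((1 - x) * x ^ m) = x ^ m + (\<Sum>j<m. real (Suc j) *\<^sub>R ((1 - x) * (1 - x) * x ^ j))"
proof (induction m)
  case (Suc m)
  have "(\<Sum>j<Suc m. real (Suc j) *\<^sub>R ((1 - x) * (1 - x) * x ^ j)) =
      1 - real m *\<^sub>R ((1 - x) * x ^ m) - x ^ m + real (Suc m) *\<^sub>R ((1 - x) * (1 - x) * x ^ m)"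
    using Suc by (simp add: algebra_simps)
  also have "\<dots> + x ^ Suc m = 1 - real (Suc m) *\<^sub>R ((1 - x) * x ^ Suc m)"
    by (simp add: algebra_simps power_commutes)
  finally show ?case by (simp only: add.commute)
qed simp

text \<open>No root of \<open>u\<close> itself is at hand, so the root \<open>s\<close> of
  \<open>u + d\<close> is used and \<open>w * s\<close> is squared. The surplus \<open>d w^2\<close>
  is absorbed by \<open>e\<close>, because \<open>d\<close> is scaled by
  \<open>(norm w)^2 + 1\<close>.\<close>

lemma pos_square_mult:
  assumes "pos u" "st w = w" "w * u = u * w"
  shows "pos (w * w * u)"
proof (rule pos_approx)
  fix e :: real assume e: "e > 0"
  define d where "d = e / ((norm w)\<^sup>2 + 1)"
  have D: "(norm w)\<^sup>2 + 1 > 0" by (simp add: add_nonneg_pos)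
  then have d: "d > 0" "d * ((norm w)\<^sup>2 + 1) = e" using e by (simp_all add: d_def)
  obtain s where s: "st s = s" "s * s = u + of_real d" "bicommutes u s"
    using pos_sqrt_strict[OF assms(1) d(1)] by auto
  have ws: "w * s = s * w" using assms(3) s(3) by (rule bicommutesD[rotated])
  have "(w * s) * (w * s) = w * w * (s * s)" by (metis ws mult.assoc)
  also have "\<dots> = w * w * u + d *\<^sub>R (w * w)"
    by (simp add: s(2) distrib_left of_real_def)
  finally have 1: "pos (w * w * u + d *\<^sub>R (w * w))"
    using pos_square[of "w * s"] assms s ws by (simp add: st_mult)
  have "norm (w * w) \<le> (norm w)\<^sup>2 + 1"
    by (simp add: norm_square_sa assms(2))
  then have "pos (of_real ((norm w)\<^sup>2 + 1) - w * w)"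
    by (intro pos_of_norm_le) (simp_all add: st_mult assms(2))
  then have "pos (d *\<^sub>R (of_real ((norm w)\<^sup>2 + 1) - w * w))"
    using d by (intro pos_scaleR) auto
  also have "d *\<^sub>R (of_real ((norm w)\<^sup>2 + 1) - w * w) = of_real e - d *\<^sub>R (w * w)"
    unfolding d(2)[symmetric] by (simp add: of_real_def scaleR_diff_right)
  finally have "pos (w * w * u + d *\<^sub>R (w * w) + (of_real e - d *\<^sub>R (w * w)))"
    by (rule pos_add[OF 1])
  then show "pos (w * w * u + of_real e)" by simp
qed

lemma pos_square_mult_power:
  assumes "pos u" "st v = v" "v * u = u * v"
  shows "pos (v * v * u ^ j)"
proof -
  define w where "w = v * u ^ (j div 2)"
  have comm: "v * u ^ i = u ^ i * v" for i
    using assms(3) by (simp add: power_commuting_commutes)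
  have w: "st w = w" "w * u = u * w"
    using assms comm by (simp_all add: w_def st_mult st_power pos_sa mult.assoc)
      (metis power_commutes mult.assoc)
  have ww: "w * w = v * v * u ^ (2 * (j div 2))"
    unfolding w_def mult_2 power_add using comm by (metis mult.assoc)
  show ?thesis
  proof (cases "even j")
    case True
    then show ?thesis using pos_square[OF w(1)] by (simp add: ww)
  next
    case False
    then have "u ^ j = u ^ (2 * (j div 2)) * u"
      by (metis odd_two_times_div_two_succ Suc_eq_plus1 power_Suc2)
    then have "v * v * u ^ j = w * w * u"
      by (simp only: ww mult.assoc)
    then show ?thesis using pos_square_mult[OF assms(1) w] by (simp only:)
  qed
qed

lemma pos_power_bound:
  assumes "pos u"
  shows "pos (1 - real m *\<^sub>R ((1 - u) * u ^ m))"
  unfolding power_sos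
proof (intro pos_add pos_sum pos_scaleR)
  show "pos (u ^ m)" using pos_square_mult_power[OF assms, of 1 m] by simp
  show "pos ((1 - u) * (1 - u) * u ^ j)" for j
    using pos_sa[OF assms]
    by (intro pos_square_mult_power assms) (simp_all add: st_diff left_diff_distrib right_diff_distrib)
qed simp

text \<open>With \<open>h = st b * b\<close>, \<open>u = 1 - h\<close> and \<open>c = b * u ^ n\<close> one has
  \<open>st c * c = (1 - u) * u ^ (2 * n) \<le> 1 / (2 * n)\<close>, hence also \<open>norm (st c * c) \<le> 1 / (2 * n)\<close>.
  So the powers of \<open>u\<close> grow at most linearly, which forces \<open>norm u \<le> 1\<close>.\<close>

theorem pos_st_mult: "pos (st b * b)"
proof -
  have unit: "pos (st b * b)" if b: "norm b \<le> 1" for b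
  proof -
    define h u where "h = st b * b" and "u = 1 - h"
    have sh: "st h = h" "norm h \<le> 1"
      using b power_le_one[of "norm b" 2] by (simp_all add: h_def st_mult st_st norm_st_mult)
    have pu: "pos u" unfolding u_def using pos_of_norm_le[OF sh] by simp
    have su: "st u = u" using pu by (rule pos_sa)
    have hu: "h = 1 - u" by (simp add: u_def)
    have step: "norm (u ^ (2 * n) - u ^ Suc (2 * n)) \<le> 1 / (2 * n)" if n: "n > 0" for n
    proof -
      define c where "c = b * u ^ n"
      have "st c * c = u ^ n * h * u ^ n"
        by (simp add: c_def st_mult st_power su h_def mult.assoc)
      also have "\<dots> = (1 - u) * u ^ (2 * n)"
        unfolding hu mult_2 power_add
        by (simp only: left_diff_distrib right_diff_distrib mult_1_left mult_1_right power_commutes mult.assoc)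
      finally have c: "st c * c = (1 - u) * u ^ (2 * n)" .
      have "pos ((1 / (2 * n)) *\<^sub>R (1 - real (2 * n) *\<^sub>R (st c * c)))"
        unfolding c by (intro pos_scaleR pos_power_bound pu) simp
      then have "pos (of_real (1 / (2 * n)) - st c * c)"
        using n by (simp add: scaleR_diff_right of_real_def)
      then have "(norm c)\<^sup>2 \<le> 1 / (2 * n)" by (rule norm_st_mult_le) simp
      then show ?thesis
        unfolding norm_st_mult[symmetric] c by (simp add: left_diff_distrib)
    qed
    have nu: "norm u \<le> 2"
      using norm_triangle_ineq4[of 1 h] sh unfolding u_def by simp
    \<comment> \<open>For \<open>n > 0\<close> the difference \<open>?d\<close> has norm at most 1
      by \<open>step\<close>, and \<open>norm u \<le> 2\<close>, so two factors cost at most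
      \<open>1 + 2 = 3\<close>. For \<open>n = 0\<close> the bound is
      \<open>2^2 = 1 + 3\<close>.\<close>
    have step2: "norm (u ^ (2 * Suc n)) \<le> norm (u ^ (2 * n)) + 3" for n
    proof (cases "n = 0")
      case True
      then show ?thesis using nu norm_square_sa[OF su] power_mono[OF nu, of 2]
        by (simp add: power2_eq_square)
    next
      case False
      let ?d = "u ^ (2 * n) - u ^ Suc (2 * n)"
      have d: "norm ?d \<le> 1"
        using False by (intro order_trans[OF step]) auto
      have "u ^ (2 * Suc n) = u ^ (2 * n) - ?d - u * ?d"
        by (simp add: right_diff_distrib)
      then have "norm (u ^ (2 * Suc n)) \<le> norm (u ^ (2 * n)) + norm ?d + norm (u * ?d)"
        using norm_triangle_ineq4[of "u ^ (2 * n)" ?d] norm_triangle_ineq4[of "u ^ (2 * n) - ?d" "u * ?d"]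
        by simp
      moreover have "norm (u * ?d) \<le> 2 * 1"
        using nu d by (intro order_trans[OF norm_mult_ineq] mult_mono) auto
      ultimately show ?thesis using d by linarith
    qed
    have lin: "norm (u ^ (2 * n)) \<le> 1 + 3 * real n" for n
    proof (induction n)
      case (Suc n)
      then show ?case using step2[of n] by simp
    qed simp
    have "norm u \<le> 1"
    proof (rule linear_growth_imp_le_1)
      fix m :: nat
      show "norm u ^ 2 ^ m \<le> 4 + 3 * 2 ^ m"
      proof (cases m)
        case 0
        then show ?thesis using nu by simp
      next
        case (Suc k)
        have "norm u ^ 2 ^ m = norm (u ^ (2 * 2 ^ k))"
          using norm_power_sa[OF su, of m] Suc by simp
        also have "\<dots> \<le> 1 + 3 * 2 ^ k" using lin[of "2 ^ k"] by simp
        also have "\<dots> \<le> 4 + 3 * 2 ^ m" by (simp add: Suc)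
        finally show ?thesis .
      qed
    qed simp
    then show ?thesis
      using sh by (intro posI[of _ 1]) (auto simp: u_def h_def)
  qed
  have nb: "norm b + 1 > 0" by (simp add: add_nonneg_pos)
  have "pos (st ((1 / (norm b + 1)) *\<^sub>R b) * ((1 / (norm b + 1)) *\<^sub>R b))"
    by (rule unit) (use nb in \<open>simp add: field_simps\<close>)
  then have "pos ((norm b + 1)\<^sup>2 *\<^sub>R (st ((1 / (norm b + 1)) *\<^sub>R b) * ((1 / (norm b + 1)) *\<^sub>R b)))"
    by (rule pos_scaleR) simp
  then show ?thesis using nb by (simp add: st_scaleR power2_eq_square)
qed

lemma pos_mult_st: "pos (c * st c)"
  using pos_st_mult[of "st c"] by (simp add: st_st)

lemma norm_le_of_pos_le:
  assumes "pos a" "pos (of_real t - a)" shows "norm a \<le> t"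
proof (rule norm_le_of_pos)
  have "of_real t + a = (of_real t - a) + (a + a)" by simp
  then show "pos (of_real t + a)"
    using assms pos_add by metis
qed (rule assms)

end

section \<open>Means over finite lists\<close>

definition list_mean :: "'i list \<Rightarrow> ('i \<Rightarrow> 'b::real_vector) \<Rightarrow> 'b" where
  "list_mean xs F = (1 / real (length xs)) *\<^sub>R (\<Sum>x\<leftarrow>xs. F x)"

lemma list_mean_map: "list_mean (map g xs) F = list_mean xs (\<lambda>x. F (g x))"
  by (simp add: list_mean_def comp_def)

lemma sum_list_linear: "linear T \<Longrightarrow> T (\<Sum>x\<leftarrow>xs. F x) = (\<Sum>x\<leftarrow>xs. T (F x))"
  by (induction xs) (simp_all add: linear_0 linear_add)

lemma linear_list_mean: "linear T \<Longrightarrow> T (list_mean xs F) = list_mean xs (\<lambda>x. T (F x))"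
  by (simp add: list_mean_def linear_scale sum_list_linear)

lemma list_mean_add: "list_mean xs (\<lambda>x. F x + G x) = list_mean xs F + list_mean xs G"
  by (simp add: list_mean_def sum_list_addf scaleR_add_right)

lemma list_mean_diff: "list_mean xs (\<lambda>x. F x - G x) = list_mean xs F - list_mean xs G"
  for F :: "'i \<Rightarrow> 'b::real_vector"
  by (simp add: list_mean_def sum_list_subtractf scaleR_diff_right)

lemma list_mean_sum: "list_mean xs (\<lambda>x. \<Sum>k\<in>K. F k x) = (\<Sum>k\<in>K. list_mean xs (F k))"
  by (induction K rule: infinite_finite_induct) (simp_all add: list_mean_add, simp_all add: list_mean_def)

lemma list_mean_const [simp]: "xs \<noteq> [] \<Longrightarrow> list_mean xs (\<lambda>x. c) = c"
proof -
  have "(\<Sum>x\<leftarrow>xs. c) = real (length xs) *\<^sub>R c"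
    by (induction xs) (simp_all add: scaleR_left_distrib)
  then show "xs \<noteq> [] \<Longrightarrow> list_mean xs (\<lambda>x. c) = c" by (simp add: list_mean_def)
qed

lemma list_mean_cong: "(\<And>x. x \<in> set xs \<Longrightarrow> F x = G x) \<Longrightarrow> list_mean xs F = list_mean xs G"
  unfolding list_mean_def by (metis map_eq_conv)

lemma list_mean_scaleR: "list_mean xs (\<lambda>x. r *\<^sub>R F x) = r *\<^sub>R list_mean xs F"
  by (rule linear_list_mean[symmetric]) (rule linear_scaleR)

lemma norm_sum_list_le:
  "(\<And>x. x \<in> set xs \<Longrightarrow> norm (F x) \<le> b) \<Longrightarrow> norm (\<Sum>x\<leftarrow>xs. F x) \<le> real (length xs) * b"
  for F :: "'i \<Rightarrow> 'b::real_normed_vector"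
proof (induction xs)
  case (Cons x xs)
  then have "norm (F x) \<le> b" "norm (\<Sum>x\<leftarrow>xs. F x) \<le> real (length xs) * b" by auto
  then show ?case
    using norm_triangle_ineq[of "F x" "\<Sum>x\<leftarrow>xs. F x"] by (simp add: algebra_simps)
qed simp

lemma norm_list_mean_le:
  fixes F :: "'i \<Rightarrow> 'b::real_normed_vector"
  assumes "\<And>x. x \<in> set xs \<Longrightarrow> norm (F x) \<le> b" "xs \<noteq> []"
  shows "norm (list_mean xs F) \<le> b"
proof -
  have "norm (list_mean xs F) \<le> (1 / real (length xs)) * (real (length xs) * b)"
    unfolding list_mean_def norm_scaleR by (intro mult_mono norm_sum_list_le assms) auto
  then show ?thesis using assms(2) by simp
qed

lemma list_mean_swap:
  "list_mean xs (\<lambda>x. list_mean ys (F x)) = list_mean ys (\<lambda>y. list_mean xs (\<lambda>x. F x y))"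
proof -
  have "(\<Sum>x\<leftarrow>xs. \<Sum>y\<leftarrow>ys. F x y) = (\<Sum>y\<leftarrow>ys. \<Sum>x\<leftarrow>xs. F x y)"
    by (induction xs) (simp_all add: sum_list_addf)
  then show ?thesis
    by (simp add: list_mean_def sum_list_linear[OF linear_scaleR, symmetric] mult.commute)
qed

text \<open>Convolution of finite means. Lists rather than sets keep multiplicities, since different
  pairs may have the same sum.\<close>

definition list_plus :: "'g::plus list \<Rightarrow> 'g list \<Rightarrow> 'g list" where
  "list_plus xs ys = concat (map (\<lambda>x. map ((+) x) ys) xs)"

lemma list_plus_eq_Nil [simp]: "list_plus xs ys = [] \<longleftrightarrow> xs = [] \<or> ys = []"
  by (auto simp: list_plus_def)

lemma list_mean_plus: "list_mean (list_plus xs ys) F = list_mean xs (\<lambda>x. list_mean ys (\<lambda>y. F (x + y)))"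
proof -
  have "length (list_plus xs ys) = length xs * length ys"
    by (induction xs) (simp_all add: list_plus_def)
  moreover have "(\<Sum>z\<leftarrow>list_plus xs ys. F z) = (\<Sum>x\<leftarrow>xs. \<Sum>y\<leftarrow>ys. F (x + y))"
    by (induction xs) (simp_all add: list_plus_def comp_def)
  ultimately show ?thesis
    by (simp add: list_mean_def sum_list_linear[OF linear_scaleR, symmetric])
qed

lemma norm_list_mean_le_of_one_small:
  fixes F :: "'i \<Rightarrow> 'b::real_normed_vector"
  assumes "\<And>x. x \<in> set xs \<Longrightarrow> norm (F x) \<le> D" and p: "p \<in> set xs" "norm (F p) \<le> d"
  shows "norm (list_mean xs F) \<le> (1 - 1 / real (length xs)) * D + d / real (length xs)"
proof -
  obtain us vs where xs: "xs = us @ p # vs" using p by (meson split_list)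
  have "norm (\<Sum>x\<leftarrow>us. F x) \<le> real (length us) * D" "norm (\<Sum>x\<leftarrow>vs. F x) \<le> real (length vs) * D"
    using assms(1) by (auto intro!: norm_sum_list_le simp: xs)
  then have "norm (\<Sum>x\<leftarrow>xs. F x) \<le> (real (length xs) - 1) * D + d"
    unfolding xs using p(2) norm_triangle_ineq[of "\<Sum>x\<leftarrow>us. F x" "F p + (\<Sum>x\<leftarrow>vs. F x)"]
      norm_triangle_ineq[of "F p" "\<Sum>x\<leftarrow>vs. F x"] by (simp add: algebra_simps)
  moreover have "real (length xs) > 0" using p by auto
  ultimately show ?thesis
    by (simp add: list_mean_def field_simps)
qed

text \<open>Averaging over \<open>ps\<close> moves, for any two points, at least one pair of the averaged
  translates close together, so it contracts the oscillation by a factor depending only on \<open>length ps\<close>.\<close>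

lemma exists_mean_small_oscillation:
  fixes F :: "'g::group_add \<Rightarrow> 'b::real_normed_vector"
  assumes net: "\<And>x. \<exists>p\<in>set ps. \<forall>y. norm (F (y + (p + x)) - F y) \<le> e / 4"
    and B: "\<And>x. norm (F x) \<le> B" and e: "e > 0"
  shows "\<exists>ys. ys \<noteq> [] \<and> (\<forall>x x'. norm (list_mean ys (\<lambda>y. F (y + x)) - list_mean ys (\<lambda>y. F (y + x'))) \<le> e)"
proof -
  have ps: "ps \<noteq> []" using net[of 0] by auto
  define q where "q = 1 / real (length ps)"
  have q: "0 < q" "q \<le> 1" using ps by (auto simp: q_def field_simps Suc_le_eq)
  \<comment> \<open>Among the pairs of points of \<open>ps\<close> one pair, of weight at least
    \<open>q * q\<close>, contributes at most \<open>e / 2\<close> instead of the full oscillation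
    \<open>D\<close>. The recursion \<open>D \<mapsto> k D + q q e / 2\<close> has the fixed point
    \<open>e / 2\<close>, which is the constant part of the bound below.\<close>
  define k where "k = 1 - q * q"
  have k: "0 \<le> k" "k < 1" using q mult_le_one[of q q] by (auto simp: k_def)
  have "\<exists>ys. ys \<noteq> [] \<and> (\<forall>x x'. norm (list_mean ys (\<lambda>y. F (y + x)) - list_mean ys (\<lambda>y. F (y + x'))) 
      \<le> k ^ n * (2 * B) + e / 2)" for n
  proof (induction n)
    case 0
    have "norm (F x - F x') \<le> 2 * B + e / 2" for x x'
      using norm_triangle_ineq4[of "F x" "F x'"] B[of x] B[of x'] e by linarith
    then show ?case by (intro exI[of _ "[0]"]) (simp add: list_mean_def)
  next
    case (Suc n)
    define D where "D = k ^ n * (2 * B) + e / 2"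
    obtain ys where ys: "ys \<noteq> []"
      and D: "\<And>x x'. norm (list_mean ys (\<lambda>y. F (y + x)) - list_mean ys (\<lambda>y. F (y + x'))) \<le> D"
      using Suc unfolding D_def by blast
    define P where "P x = list_mean ys (\<lambda>y. F (y + x))" for x
    have P': "list_mean (list_plus ys ps) (\<lambda>y. F (y + x)) = list_mean ps (\<lambda>p. P (p + x))" for x
      unfolding list_mean_plus P_def by (subst list_mean_swap) (simp add: add.assoc)
    have near: "\<exists>p\<in>set ps. norm (P (p + x) - P 0) \<le> e / 4" for x
    proof -
      obtain p where p: "p \<in> set ps" "\<And>y. norm (F (y + (p + x)) - F y) \<le> e / 4"
        using net by blast
      have "norm (P (p + x) - P 0) \<le> e / 4"
        unfolding P_def list_mean_diff[symmetric] using p ys by (intro norm_list_mean_le) auto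
      then show ?thesis using p by blast
    qed
    have "norm (list_mean ps (\<lambda>p. P (p + x)) - list_mean ps (\<lambda>p. P (p + x'))) \<le> k * D + q * q * (e / 2)" for x x'
    proof -
      obtain u v where u: "u \<in> set ps" "norm (P (u + x) - P 0) \<le> e / 4"
        and v: "v \<in> set ps" "norm (P (v + x') - P 0) \<le> e / 4"
        using near by meson
      have uv: "norm (P (u + x) - P (v + x')) \<le> e / 2"
        using norm_triangle_ineq4[of "P (u + x) - P 0" "P (v + x') - P 0"] u v by simp
      define G where "G p = list_mean ps (\<lambda>r. P (p + x) - P (r + x'))" for p
      have "list_mean ps (\<lambda>p. P (p + x)) - list_mean ps (\<lambda>p. P (p + x')) = list_mean ps G"
        unfolding G_def list_mean_diff using ps by simp
      moreover have "norm (list_mean ps G) \<le> (1 - q) * D + ((1 - q) * D + (e / 2) * q) * q"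
        unfolding q_def
      proof (rule order_trans[OF norm_list_mean_le_of_one_small[of ps G D u "(1 - q) * D + (e / 2) * q"]])
        show "norm (G p) \<le> D" for p
          unfolding G_def using D ps by (intro norm_list_mean_le) (auto simp: P_def)
        show "norm (G u) \<le> (1 - q) * D + (e / 2) * q"
          unfolding G_def q_def
          using norm_list_mean_le_of_one_small[of ps "\<lambda>r. P (u + x) - P (r + x')" D v "e / 2"] v uv D
          by (simp add: P_def)
      qed (use u in \<open>auto simp: q_def\<close>)
      ultimately show ?thesis by (simp add: k_def algebra_simps)
    qed
    moreover have "k * D + q * q * (e / 2) = k ^ Suc n * (2 * B) + e / 2"
      by (simp add: D_def k_def field_simps)
    ultimately show ?case
      using ys ps by (intro exI[of _ "list_plus ys ps"]) (simp add: P')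
  qed
  moreover have "(\<lambda>n. k ^ n * (2 * B)) \<longlonglongrightarrow> 0"
    using k by (intro tendsto_mult_left_zero LIMSEQ_power_zero) auto
  then have "\<forall>\<^sub>F n in sequentially. k ^ n * (2 * B) < e / 2"
    using e by (intro order_tendstoD(2)) auto
  then obtain n where "k ^ n * (2 * B) < e / 2"
    using eventually_happens by fastforce
  ultimately show ?thesis by (smt (verit, best) field_sum_of_halves)
qed

section \<open>The action and almost invariant means of orbits\<close>

locale ergodic_action = cstar sm st
  for sm :: "complex \<Rightarrow> 'a::{real_normed_algebra_1,banach} \<Rightarrow> 'a" and st :: "'a \<Rightarrow> 'a" +
  fixes \<alpha> :: "'g::{t2_space,group_add} \<Rightarrow> 'a \<Rightarrow> 'a" and l :: "'g \<Rightarrow> real"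
  assumes compact_group: "compact_group TYPE('g)"
    and ergodic_action: "ergodic_strongly_continuous_action sm st \<alpha>"
    and length_function: "continuous_length_function l"
begin

lemma alpha_automorphism: "star_automorphism sm st (\<alpha> x)"
  using ergodic_action by (simp add: ergodic_strongly_continuous_action_def)

lemma alpha_add: "\<alpha> x (a + b) = \<alpha> x a + \<alpha> x b"
  and alpha_sm: "\<alpha> x (sm c a) = sm c (\<alpha> x a)"
  and alpha_mult: "\<alpha> x (a * b) = \<alpha> x a * \<alpha> x b"
  and alpha_1 [simp]: "\<alpha> x 1 = 1"
  and alpha_st: "\<alpha> x (st a) = st (\<alpha> x a)"
  using alpha_automorphism[of x] unfolding star_automorphism_def by metis+

lemma alpha_scaleR: "\<alpha> x (r *\<^sub>R a) = r *\<^sub>R \<alpha> x a"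
  by (metis alpha_sm sm_of_real)

lemma linear_alpha: "linear (\<alpha> x)"
  by (rule linearI) (simp_all add: alpha_add alpha_scaleR)

lemmas alpha_diff = linear_diff[OF linear_alpha]

lemma alpha_of_real [simp]: "\<alpha> x (of_real r) = of_real r"
  by (simp add: of_real_def alpha_scaleR)

lemma alpha_0 [simp]: "\<alpha> 0 a = a"
  and alpha_plus: "\<alpha> (x + y) a = \<alpha> x (\<alpha> y a)"
  using ergodic_action by (simp_all add: ergodic_strongly_continuous_action_def)

lemma alpha_minus [simp]: "\<alpha> (- x) (\<alpha> x a) = a" "\<alpha> x (\<alpha> (- x) a) = a"
  by (simp_all flip: alpha_plus)

lemma invariant_imp_scalar: "(\<And>x. \<alpha> x a = a) \<Longrightarrow> \<exists>c. a = sm c 1"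
  using ergodic_action by (auto simp: ergodic_strongly_continuous_action_def)

lemma continuous_on_alpha: "continuous_on UNIV (\<lambda>x. \<alpha> x a)"
  using ergodic_action by (simp add: ergodic_strongly_continuous_action_def)

lemma compact_UNIV_group: "compact (UNIV :: 'g set)"
  using compact_group by (simp add: compact_group_def)

text \<open>Automorphisms are given only algebraically, so the root of \<open>h + e\<close> is
  transported. That they are isometries (\<open>norm_alpha\<close>) is then read off from the
  order.\<close>

lemma pos_alpha:
  assumes "pos h" shows "pos (\<alpha> x h)"
proof (rule pos_approx)
  fix e :: real assume "e > 0"
  with assms obtain s where s: "st s = s" "s * s = h + of_real e"
    using pos_sqrt_strict by blast
  have "pos (\<alpha> x s * \<alpha> x s)"
    using s by (intro pos_square) (simp flip: alpha_st)
  then show "pos (\<alpha> x h + of_real e)"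
    by (simp add: s alpha_add flip: alpha_mult)
qed

lemma norm_alpha [simp]: "norm (\<alpha> x a) = norm a"
proof -
  have le: "norm (\<alpha> x a) \<le> norm a" for x a
  proof -
    have "pos (of_real ((norm a)\<^sup>2) - st a * a)"
      by (intro pos_of_norm_le) (simp_all add: st_mult st_st norm_st_mult)
    then have "pos (\<alpha> x (of_real ((norm a)\<^sup>2) - st a * a))" by (rule pos_alpha)
    then have "pos (of_real ((norm a)\<^sup>2) - st (\<alpha> x a) * \<alpha> x a)"
      by (simp only: alpha_diff alpha_of_real alpha_mult alpha_st)
    then have "(norm (\<alpha> x a))\<^sup>2 \<le> (norm a)\<^sup>2" by (rule norm_st_mult_le) simp
    then show ?thesis by (rule power2_le_imp_le) simp
  qed
  show ?thesis using le[of x a] le[of "- x" "\<alpha> x a"] by simp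
qed

text \<open>Strong continuity is pointwise. It becomes uniform over the orbit because closeness has
  to be arranged only on a finite net \<open>K\<close> of the compact orbit; the other points follow
  by isometry.\<close>

lemma orbit_net:
  assumes e: "e > 0"
  obtains Q where "finite Q" "\<And>x. \<exists>q\<in>Q. \<forall>y. norm (\<alpha> q (\<alpha> y a) - \<alpha> x (\<alpha> y a)) \<le> e"
proof -
  have "compact (range (\<lambda>y. \<alpha> y a))"
    by (intro compact_continuous_image continuous_on_alpha compact_UNIV_group)
  then obtain K where K: "finite K" "range (\<lambda>y. \<alpha> y a) \<subseteq> (\<Union>b\<in>K. ball b (e/3))"
    unfolding compact_eq_totally_bounded using e by (meson zero_less_divide_iff zero_less_numeral)
  define W where "W q = (\<Inter>b\<in>K. {x. norm (\<alpha> q b - \<alpha> x b) < e/3})" for q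
  have "open (W q)" for q
    unfolding W_def using K
    by (intro open_INT ballI open_Collect_less continuous_intros continuous_on_alpha)
  moreover have "UNIV \<subseteq> (\<Union>q\<in>UNIV. W q)" using e by (auto simp: W_def)
  ultimately obtain Q where Q: "finite Q" "UNIV \<subseteq> (\<Union>q\<in>Q. W q)"
    using compactE_image[OF compact_UNIV_group, of UNIV W] by auto
  show thesis
  proof (rule that[OF Q(1)])
    fix x
    obtain q where q: "q \<in> Q" "x \<in> W q" using Q by blast
    have "norm (\<alpha> q (\<alpha> y a) - \<alpha> x (\<alpha> y a)) \<le> e" for y
    proof -
      obtain b where b: "b \<in> K" "norm (b - \<alpha> y a) < e/3"
        using K by (auto simp: dist_norm subset_iff) 
      have eq: "\<alpha> q (\<alpha> y a) - \<alpha> x (\<alpha> y a) = (\<alpha> q b - \<alpha> x b) - \<alpha> q (b - \<alpha> y a) + \<alpha> x (b - \<alpha> y a)"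
        by (simp add: alpha_diff)
      have "norm (\<alpha> q b - \<alpha> x b) < e/3" using q b by (auto simp: W_def)
      then show ?thesis
        unfolding eq using b norm_triangle_ineq[of "(\<alpha> q b - \<alpha> x b) - \<alpha> q (b - \<alpha> y a)" "\<alpha> x (b - \<alpha> y a)"]
          norm_triangle_ineq4[of "\<alpha> q b - \<alpha> x b" "\<alpha> q (b - \<alpha> y a)"] by simp
    qed
    then show "\<exists>q\<in>Q. \<forall>y. norm (\<alpha> q (\<alpha> y a) - \<alpha> x (\<alpha> y a)) \<le> e" using q by blast
  qed
qed

definition av :: "'g list \<Rightarrow> 'a \<Rightarrow> 'a" where
  "av xs a = list_mean xs (\<lambda>x. \<alpha> x a)"

lemma linear_av: "linear (av xs)"
  unfolding av_def
  by (rule linearI) (simp_all add: alpha_add list_mean_add alpha_scaleR list_mean_scaleR)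

lemma av_plus: "av (list_plus xs ys) a = av xs (av ys a)"
  by (simp add: av_def list_mean_plus alpha_plus linear_list_mean[OF linear_alpha])

lemma av_sm: "av xs (sm c a) = sm c (av xs a)"
  by (simp add: av_def alpha_sm linear_list_mean[OF sm_linear])

lemma av_st: "av xs (st a) = st (av xs a)"
  by (simp add: av_def alpha_st linear_list_mean[OF st_linear])

lemma av_1 [simp]: "xs \<noteq> [] \<Longrightarrow> av xs 1 = 1"
  by (simp add: av_def)

lemma norm_av_le: "xs \<noteq> [] \<Longrightarrow> norm (av xs a) \<le> norm a"
  unfolding av_def by (rule norm_list_mean_le) simp_all

lemma norm_av_diff_le: "xs \<noteq> [] \<Longrightarrow> (\<And>x. x \<in> set xs \<Longrightarrow> norm (\<alpha> x a - b) \<le> r) \<Longrightarrow> norm (av xs a - b) \<le> r"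
  using norm_list_mean_le[of xs "\<lambda>x. \<alpha> x a - b" r] by (simp add: av_def list_mean_diff)

text \<open>The oscillation lemma is applied to \<open>F y = \<alpha> (- y) a\<close>: inversion
  turns the left factor \<open>\<alpha> x\<close> into the right translation by
  \<open>- x\<close>.\<close>

lemma exists_av_almost_invariant:
  assumes e: "e > 0"
  shows "\<exists>xs. xs \<noteq> [] \<and> (\<forall>x. norm (\<alpha> x (av xs a) - av xs a) \<le> e)"
proof -
  obtain Q where Q: "finite Q" "\<And>x. \<exists>q\<in>Q. \<forall>y. norm (\<alpha> q (\<alpha> y a) - \<alpha> x (\<alpha> y a)) \<le> e / 4"
    using orbit_net[of "e / 4" a] e by auto
  obtain qs where qs: "set qs = Q" using Q(1) finite_list by blast
  have "\<exists>ys. ys \<noteq> [] \<and> (\<forall>x x'. norm (list_mean ys (\<lambda>y. \<alpha> (- (y + x)) a) - list_mean ys (\<lambda>y. \<alpha> (- (y + x')) a)) \<le> e)"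
  proof (rule exists_mean_small_oscillation[of "map uminus qs"])
    fix x
    obtain q where q: "q \<in> Q" "\<And>y. norm (\<alpha> q (\<alpha> y a) - \<alpha> x (\<alpha> y a)) \<le> e / 4" using Q by blast
    have "norm (\<alpha> (- (y + (- q + x))) a - \<alpha> (- y) a) \<le> e / 4" for y
    proof -
      have "\<alpha> (- (y + (- q + x))) a - \<alpha> (- y) a = \<alpha> (- x) (\<alpha> q (\<alpha> (- y) a) - \<alpha> x (\<alpha> (- y) a))"
      proof -
        have "- (y + (- q + x)) = - x + (q + - y)"
          by (simp add: minus_add add.assoc del: add_uminus_conv_diff)
        then show ?thesis by (simp only: alpha_plus alpha_diff alpha_minus)
      qed
      then show ?thesis using q(2)[of "- y"] by simp
    qed
    then show "\<exists>p\<in>set (map uminus qs). \<forall>y. norm (\<alpha> (- (y + (p + x))) a - \<alpha> (- y) a) \<le> e / 4"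
      using q qs by auto
  qed (use e in auto)
  then obtain ys where ys: "ys \<noteq> []"
    "\<And>x x'. norm (list_mean ys (\<lambda>y. \<alpha> (- (y + x)) a) - list_mean ys (\<lambda>y. \<alpha> (- (y + x')) a)) \<le> e"
    by blast
  have "norm (\<alpha> x (av (map uminus ys) a) - av (map uminus ys) a) \<le> e" for x
  proof -
    have "\<alpha> x (av (map uminus ys) a) = list_mean ys (\<lambda>y. \<alpha> (- (y + - x)) a)"
      by (simp only: av_def list_mean_map linear_list_mean[OF linear_alpha] alpha_plus[symmetric]
        minus_add minus_minus)
    then show ?thesis using ys(2)[of "- x" 0] by (simp add: av_def list_mean_map)
  qed
  then show ?thesis using ys(1) by (intro exI[of _ "map uminus ys"]) auto
qed

text \<open>Counterpart on the other side: here the mean does not notice the starting point on the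
  orbit, whereas in \<open>exists_av_almost_invariant\<close> the mean itself is almost fixed by the
  action. The two differ for a noncommutative group.\<close>

lemma exists_av_almost_constant:
  assumes e: "e > 0"
  shows "\<exists>ys. ys \<noteq> [] \<and> (\<forall>x. norm (av ys (\<alpha> x a) - av ys a) \<le> e)"
proof -
  obtain Q where Q: "finite Q" "\<And>x. \<exists>q\<in>Q. \<forall>y. norm (\<alpha> q (\<alpha> y a) - \<alpha> x (\<alpha> y a)) \<le> e / 4"
    using orbit_net[of "e / 4" a] e by auto
  obtain qs where qs: "set qs = Q" using Q(1) finite_list by blast
  have "\<exists>ys. ys \<noteq> [] \<and> (\<forall>x x'. norm (list_mean ys (\<lambda>y. \<alpha> (y + x) a) - list_mean ys (\<lambda>y. \<alpha> (y + x') a)) \<le> e)"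
  proof (rule exists_mean_small_oscillation[of "map uminus qs"])
    fix x
    obtain q where q: "q \<in> Q" "\<And>y. norm (\<alpha> q (\<alpha> y a) - \<alpha> x (\<alpha> y a)) \<le> e / 4" using Q by blast
    have "norm (\<alpha> (y + (- q + x)) a - \<alpha> y a) \<le> e / 4" for y
    proof -
      have "\<alpha> (y + (- q + x)) a - \<alpha> y a = - \<alpha> y (\<alpha> (- q) (\<alpha> q a - \<alpha> x a))"
        by (simp add: alpha_plus alpha_diff)
      then show ?thesis using q(2)[of 0] by simp
    qed
    then show "\<exists>p\<in>set (map uminus qs). \<forall>y. norm (\<alpha> (y + (p + x)) a - \<alpha> y a) \<le> e / 4"
      using q qs by auto
  qed (use e in auto)
  then obtain ys where ys: "ys \<noteq> []"
    "\<And>x x'. norm (list_mean ys (\<lambda>y. \<alpha> (y + x) a) - list_mean ys (\<lambda>y. \<alpha> (y + x') a)) \<le> e"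
    by blast
  then have "norm (av ys (\<alpha> x a) - av ys a) \<le> e" for x
    using ys(2)[of x 0] by (simp add: av_def alpha_plus)
  then show ?thesis using ys(1) by blast
qed

section \<open>The invariant state\<close>


text \<open>If the action moves an element by at most \<open>(1/2)^n\<close>, any mean of its
  translates is that close to it. So iterated means with shrinking defect form a Cauchy sequence,
  whose limit is invariant and hence scalar by ergodicity.\<close>

lemma exists_scalar_mean:
  "\<exists>c. \<forall>e>0. \<exists>xs. xs \<noteq> [] \<and> norm (av xs a - sm c 1) \<le> e"
proof -
  define P where "P n b \<longleftrightarrow> (\<exists>xs. xs \<noteq> [] \<and> b = av xs a) \<and> (\<forall>x. norm (\<alpha> x b - b) \<le> (1/2) ^ n)"
    for n :: nat and b
  have "\<exists>f. \<forall>n. P n (f n) \<and> norm (f (Suc n) - f n) \<le> (1/2) ^ n"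
  proof (rule dependent_nat_choice)
    show "\<exists>b. P 0 b"
      using exists_av_almost_invariant[of "(1/2) ^ 0" a] unfolding P_def by auto
  next
    fix b n assume "P n b"
    then obtain xs where xs: "xs \<noteq> []" "b = av xs a" and b: "\<And>x. norm (\<alpha> x b - b) \<le> (1/2) ^ n"
      unfolding P_def by blast
    obtain ys where ys: "ys \<noteq> []" "\<And>x. norm (\<alpha> x (av ys b) - av ys b) \<le> (1/2) ^ Suc n"
      using exists_av_almost_invariant[of "(1/2) ^ Suc n" b] by auto
    have "P (Suc n) (av ys b)"
      unfolding P_def xs(2) av_plus[symmetric] using xs ys
      by (auto simp del: power_Suc simp: av_plus intro!: exI[of _ "list_plus ys xs"])
    moreover have "norm (av ys b - b) \<le> (1/2) ^ n"
      using ys(1) b by (rule norm_av_diff_le)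
    ultimately show "\<exists>b'. P (Suc n) b' \<and> norm (b' - b) \<le> (1/2) ^ n" by blast
  qed
  then obtain f where f: "\<And>n. P n (f n)" "\<And>n. norm (f (Suc n) - f n) \<le> (1/2) ^ n" by blast
  have "summable (\<lambda>n. f (Suc n) - f n)"
    by (rule summable_comparison_test'[OF summable_geometric f(2)]) simp
  then have "(\<lambda>n. f 0 + (\<Sum>k<n. f (Suc k) - f k)) \<longlonglongrightarrow> f 0 + (\<Sum>k. f (Suc k) - f k)"
    by (intro tendsto_add tendsto_const summable_LIMSEQ)
  then obtain b where b: "f \<longlonglongrightarrow> b" by (auto simp: sum_lessThan_telescope)
  have "\<alpha> x b = b" for x
  proof -
    have "(\<lambda>n. 2 * norm (f n - b) + (1/2) ^ n) \<longlonglongrightarrow> 2 * 0 + 0"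
      using b by (intro tendsto_add tendsto_mult tendsto_const LIMSEQ_power_zero tendsto_norm_zero)
        (auto simp: LIM_zero_iff)
    moreover have "norm (\<alpha> x b - b) \<le> 2 * norm (f n - b) + (1/2) ^ n" for n
    proof -
      have eq: "\<alpha> x b - b = (\<alpha> x (f n) - f n) + ((f n - b) - \<alpha> x (f n - b))"
        by (simp add: alpha_diff)
      have "norm (\<alpha> x (f n) - f n) \<le> (1/2) ^ n" using f(1) unfolding P_def by blast
      then show ?thesis
        unfolding eq using norm_triangle_ineq[of "\<alpha> x (f n) - f n" "(f n - b) - \<alpha> x (f n - b)"]
          norm_triangle_ineq4[of "f n - b" "\<alpha> x (f n - b)"] by simp
    qed
    ultimately have "norm (\<alpha> x b - b) \<le> 0"
      by (intro LIMSEQ_le_const[of "\<lambda>n. 2 * norm (f n - b) + (1/2) ^ n"]) auto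
    then show ?thesis by simp
  qed
  then obtain c where c: "b = sm c 1" using invariant_imp_scalar by blast
  have "\<exists>xs. xs \<noteq> [] \<and> norm (av xs a - sm c 1) \<le> e" if e: "e > 0" for e
  proof -
    obtain n where "norm (f n - b) < e" using LIMSEQ_D[OF b e] by blast
    then show ?thesis using f(1)[of n] unfolding P_def c by (metis less_imp_le)
  qed
  then show ?thesis by blast
qed

lemma av_sm_1 [simp]: "xs \<noteq> [] \<Longrightarrow> av xs (sm c 1) = sm c 1"
  by (simp add: av_sm)

text \<open>Left means exist by ergodicity; comparing them with right means makes the value unique.\<close>

lemma exists_uniform_mean:
  "\<exists>c. \<forall>e>0. \<exists>ys. ys \<noteq> [] \<and> (\<forall>x. norm (av ys (\<alpha> x a) - sm c 1) \<le> e)"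
proof -
  obtain c where c: "\<And>e. e > 0 \<Longrightarrow> \<exists>xs. xs \<noteq> [] \<and> norm (av xs a - sm c 1) \<le> e"
    using exists_scalar_mean by blast
  have "\<exists>ys. ys \<noteq> [] \<and> (\<forall>x. norm (av ys (\<alpha> x a) - sm c 1) \<le> e)" if e: "e > 0" for e
  proof -
    obtain xs where xs: "xs \<noteq> []" "norm (av xs a - sm c 1) \<le> e / 3"
      using c[of "e / 3"] e by auto
    obtain ys where ys: "ys \<noteq> []" "\<And>x. norm (av ys (\<alpha> x a) - av ys a) \<le> e / 3"
      using exists_av_almost_constant[of "e / 3" a] e by auto
    have "av ys (av xs a) - av ys a = list_mean xs (\<lambda>x. av ys (\<alpha> x a) - av ys a)"
      using xs(1) by (simp add: list_mean_diff) (simp add: av_def[of xs] linear_list_mean[OF linear_av])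
    then have 1: "norm (av ys (av xs a) - av ys a) \<le> e / 3"
      using norm_list_mean_le[of xs "\<lambda>x. av ys (\<alpha> x a) - av ys a", OF ys(2) xs(1)] by simp
    have "av ys (av xs a) - sm c 1 = av ys (av xs a - sm c 1)"
      using ys(1) by (simp add: linear_diff[OF linear_av])
    then have 2: "norm (av ys (av xs a) - sm c 1) \<le> e / 3"
      using norm_av_le[OF ys(1), of "av xs a - sm c 1"] xs by simp
    have "norm (av ys (\<alpha> x a) - sm c 1) \<le> e" for x
    proof -
      have "norm ((av ys (\<alpha> x a) - av ys a) - (av ys (av xs a) - av ys a) + (av ys (av xs a) - sm c 1)) \<le> e"
        using 1 2 ys(2)[of x] norm_triangle_ineq4[of "av ys (\<alpha> x a) - av ys a" "av ys (av xs a) - av ys a"]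
          norm_triangle_ineq[of "(av ys (\<alpha> x a) - av ys a) - (av ys (av xs a) - av ys a)" "av ys (av xs a) - sm c 1"]
        by linarith
      then show ?thesis by simp
    qed
    then show ?thesis using ys(1) by blast
  qed
  then show ?thesis by blast
qed

text \<open>The value that Haar integration of the orbit would give. Its algebraic laws come from
  evaluating all elements involved on one common list, supplied by
  \<open>exists_good\<close>.\<close>

definition phi :: "'a \<Rightarrow> complex" where
  "phi a = (SOME c. \<forall>e>0. \<exists>ys. ys \<noteq> [] \<and> (\<forall>x. norm (av ys (\<alpha> x a) - sm c 1) \<le> e))"

text \<open>Closeness is required on the whole orbit, which makes the notion stable under composing
  with another mean on either side; so lists for finitely many elements can be merged.\<close>

definition good :: "'g list \<Rightarrow> real \<Rightarrow> 'a \<Rightarrow> bool" where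
  "good ys e a \<longleftrightarrow> ys \<noteq> [] \<and> (\<forall>x. norm (av ys (\<alpha> x a) - sm (phi a) 1) \<le> e)"

lemma exists_good1: "e > 0 \<Longrightarrow> \<exists>ys. good ys e a"
  using someI_ex[OF exists_uniform_mean[of a]] unfolding good_def phi_def by blast

lemma good_orbit: "good ys e a \<Longrightarrow> norm (av ys (\<alpha> x a) - sm (phi a) 1) \<le> e"
  by (simp add: good_def)

lemma goodD: "good ys e a \<Longrightarrow> norm (av ys a - sm (phi a) 1) \<le> e"
  using good_orbit[of ys e a 0] by simp

lemma good_plus_left:
  assumes "good ys e a" "zs \<noteq> []" shows "good (list_plus zs ys) e a"
proof -
  have "norm (av zs (av ys (\<alpha> x a)) - sm (phi a) 1) \<le> e" for x
    using norm_av_le[OF assms(2), of "av ys (\<alpha> x a) - sm (phi a) 1"] assms good_orbit[OF assms(1), of x]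
    by (simp add: linear_diff[OF linear_av])
  then show ?thesis using assms by (simp add: good_def av_plus)
qed

lemma good_plus_right:
  assumes "good ys e a" "zs \<noteq> []" shows "good (list_plus ys zs) e a"
proof -
  have "norm (av ys (av zs (\<alpha> x a)) - sm (phi a) 1) \<le> e" for x
  proof -
    have "av ys (av zs (\<alpha> x a)) - sm (phi a) 1 = list_mean zs (\<lambda>z. av ys (\<alpha> (z + x) a) - sm (phi a) 1)"
      using assms(2) by (simp add: list_mean_diff av_def[of zs] linear_list_mean[OF linear_av] alpha_plus)
    then show ?thesis
      using assms good_orbit[OF assms(1)] by (simp only:) (intro norm_list_mean_le, auto)
  qed
  then show ?thesis using assms by (simp add: good_def av_plus)
qed

lemma good_shift: "good ys e a \<Longrightarrow> good (map ((+) p) ys) e a"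
  using good_plus_left[of ys e a "[p]"] by (simp add: list_plus_def)

lemma exists_good:
  assumes "finite A" "e > 0" shows "\<exists>ys. ys \<noteq> [] \<and> (\<forall>a\<in>A. good ys e a)"
  using assms(1)
proof induction
  case empty
  then show ?case by (intro exI[of _ "[0]"]) simp
next
  case (insert a A)
  then obtain ys where ys: "ys \<noteq> []" "\<forall>a\<in>A. good ys e a" by blast
  obtain zs where zs: "good zs e a" using exists_good1 assms(2) by blast
  then have "zs \<noteq> []" by (simp add: good_def)
  with ys zs show ?case
    by (intro exI[of _ "list_plus ys zs"]) (auto intro: good_plus_left good_plus_right)
qed

lemma norm_sm_1: "norm (sm c 1) = cmod c"
  by (simp add: norm_sm)

lemma sm_of_real_1: "sm (complex_of_real r) 1 = of_real r"
  by (simp add: sm_of_real) (simp add: of_real_def)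

lemma phi_add: "phi (a + b) = phi a + phi b"
proof -
  have "cmod (phi (a + b) - (phi a + phi b)) \<le> e" if e: "e > 0" for e
  proof -
    obtain ys where ys: "good ys (e/3) a" "good ys (e/3) b" "good ys (e/3) (a + b)"
      using exists_good[of "{a, b, a + b}" "e/3"] e by auto
    have "sm (phi (a + b) - (phi a + phi b)) 1 =
      (av ys a - sm (phi a) 1) + (av ys b - sm (phi b) 1) - (av ys (a + b) - sm (phi (a + b)) 1)"
      by (simp add: sm_diff_left sm_add_left linear_add[OF linear_av])
    then have "norm (sm (phi (a + b) - (phi a + phi b)) 1) \<le> e"
      using goodD[OF ys(1)] goodD[OF ys(2)] goodD[OF ys(3)]
        norm_triangle_ineq4[of "(av ys a - sm (phi a) 1) + (av ys b - sm (phi b) 1)" "av ys (a + b) - sm (phi (a + b)) 1"]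
        norm_triangle_ineq[of "av ys a - sm (phi a) 1" "av ys b - sm (phi b) 1"] by simp
    then show ?thesis by (simp add: norm_sm_1)
  qed
  then have "cmod (phi (a + b) - (phi a + phi b)) \<le> 0" by (rule field_le_epsilon) simp
  then show ?thesis by simp
qed

lemma phi_sm: "phi (sm c a) = c * phi a"
proof -
  have "cmod (phi (sm c a) - c * phi a) \<le> e" if e: "e > 0" for e
  proof -
    define d where "d = e / (1 + cmod c)"
    have c: "1 + cmod c > 0" by (simp add: add_pos_nonneg)
    then have "d > 0" "d * (1 + cmod c) = e" using e by (simp_all add: d_def)
    then have d: "d > 0" "cmod c * d + d = e" by (simp_all add: algebra_simps)
    obtain ys where ys: "good ys d a" "good ys d (sm c a)"
      using exists_good[of "{a, sm c a}" d] d by auto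
    have "sm (phi (sm c a) - c * phi a) 1 = sm c (av ys a - sm (phi a) 1) - (av ys (sm c a) - sm (phi (sm c a)) 1)"
      by (simp add: sm_diff_left sm_diff_right sm_sm av_sm)
    then have "norm (sm (phi (sm c a) - c * phi a) 1) \<le> cmod c * d + d"
      using norm_triangle_ineq4[of "sm c (av ys a - sm (phi a) 1)" "av ys (sm c a) - sm (phi (sm c a)) 1"]
        goodD[OF ys(2)] mult_left_mono[OF goodD[OF ys(1)], of "cmod c"] by (simp add: norm_sm)
    then show ?thesis using d by (simp add: norm_sm_1)
  qed
  then have "cmod (phi (sm c a) - c * phi a) \<le> 0" by (rule field_le_epsilon) simp
  then show ?thesis by simp
qed

lemma phi_st: "phi (st a) = cnj (phi a)"
proof -
  have "cmod (phi (st a) - cnj (phi a)) \<le> e" if e: "e > 0" for e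
  proof -
    obtain ys where ys: "good ys (e/2) a" "good ys (e/2) (st a)"
      using exists_good[of "{a, st a}" "e/2"] e by auto
    have "sm (phi (st a) - cnj (phi a)) 1 = st (av ys a - sm (phi a) 1) - (av ys (st a) - sm (phi (st a)) 1)"
      by (simp add: sm_diff_left st_diff st_sm av_st)
    then have "norm (sm (phi (st a) - cnj (phi a)) 1) \<le> e"
      using norm_triangle_ineq4[of "st (av ys a - sm (phi a) 1)" "av ys (st a) - sm (phi (st a)) 1"]
        goodD[OF ys(1)] goodD[OF ys(2)] by simp
    then show ?thesis by (simp add: norm_sm_1)
  qed
  then have "cmod (phi (st a) - cnj (phi a)) \<le> 0" by (rule field_le_epsilon) simp
  then show ?thesis by simp
qed

lemma phi_alpha: "phi (\<alpha> x a) = phi a"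
proof -
  have "cmod (phi (\<alpha> x a) - phi a) \<le> e" if e: "e > 0" for e
  proof -
    obtain ys where ys: "good ys (e/2) a" "good ys (e/2) (\<alpha> x a)"
      using exists_good[of "{a, \<alpha> x a}" "e/2"] e by auto
    have "norm (sm (phi (\<alpha> x a) - phi a) 1) \<le> e"
      using norm_triangle_ineq4[of "av ys (\<alpha> x a) - sm (phi a) 1" "av ys (\<alpha> x a) - sm (phi (\<alpha> x a)) 1"]
        good_orbit[OF ys(1), of x] goodD[OF ys(2)] by (simp add: sm_diff_left)
    then show ?thesis by (simp add: norm_sm_1)
  qed
  then have "cmod (phi (\<alpha> x a) - phi a) \<le> 0" by (rule field_le_epsilon) simp
  then show ?thesis by simp
qed

lemma phi_1 [simp]: "phi 1 = 1"
proof -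
  have "cmod (1 - phi 1) \<le> e" if e: "e > 0" for e
  proof -
    obtain ys where ys: "good ys e 1" using exists_good1[OF e] by blast
    then have "ys \<noteq> []" by (simp add: good_def)
    then have "norm (sm (1 - phi 1) 1) \<le> e"
      using goodD[OF ys] by (simp add: sm_diff_left sm_1)
    then show ?thesis by (simp add: norm_sm_1)
  qed
  then have "cmod (1 - phi 1) \<le> 0" by (rule field_le_epsilon) simp
  then show ?thesis by simp
qed

lemma cmod_phi_le: "cmod (phi a) \<le> norm a"
proof (rule field_le_epsilon)
  fix e :: real assume e: "e > 0"
  obtain ys where ys: "good ys e a" using exists_good1[OF e] by blast
  then have "ys \<noteq> []" by (simp add: good_def)
  then show "cmod (phi a) \<le> norm a + e"
    using norm_triangle_ineq4[of "av ys a" "av ys a - sm (phi a) 1"] goodD[OF ys] norm_av_le[of ys a]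
    by (simp add: norm_sm_1)
qed

lemma phi_scaleR: "phi (r *\<^sub>R a) = r *\<^sub>R phi a"
  by (metis phi_sm scaleR_conv_of_real sm_of_real)

lemma linear_phi: "linear phi"
  by (rule linearI) (simp_all add: phi_add phi_scaleR)

lemmas phi_diff = linear_diff[OF linear_phi]
  and phi_sum = linear_sum[OF linear_phi]

lemma phi_of_real [simp]: "phi (of_real r) = of_real r"
  by (simp add: of_real_def phi_scaleR)

lemma phi_sa: "st h = h \<Longrightarrow> phi h = of_real (Re (phi h))"
  by (metis Reals_cnj_iff complex_is_Real_iff of_real_Re phi_st)

lemma pos_sum_list: "(\<And>x. x \<in> set xs \<Longrightarrow> pos (F x)) \<Longrightarrow> pos (\<Sum>x\<leftarrow>xs. F x)"
  by (induction xs) (auto intro: pos_add)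

lemma pos_list_mean: "(\<And>x. x \<in> set xs \<Longrightarrow> pos (F x)) \<Longrightarrow> pos (list_mean xs F)"
  unfolding list_mean_def by (intro pos_scaleR pos_sum_list) auto

lemma Re_phi_nonneg:
  assumes "pos h" shows "0 \<le> Re (phi h)"
proof (rule field_le_epsilon)
  fix e :: real assume e: "e > 0"
  obtain ys where ys: "good ys e h" using exists_good1[OF e] by blast
  define r where "r = Re (phi h)"
  have phi: "phi h = of_real r" unfolding r_def using assms by (intro phi_sa pos_sa)
  have p: "pos (av ys h)" unfolding av_def using assms by (intro pos_list_mean pos_alpha)
  have "norm (av ys h - of_real r) \<le> e" using goodD[OF ys] by (simp add: phi sm_of_real_1)
  then have "pos (of_real e - (av ys h - of_real r))"
    using pos_sa[OF p] by (intro pos_of_norm_le) (simp_all add: st_diff)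
  then have "pos (of_real e - (av ys h - of_real r) + av ys h)" using p by (rule pos_add)
  then have "pos (of_real (r + e))" by (simp add: algebra_simps)
  then show "0 \<le> Re (phi h) + e" unfolding r_def by (rule pos_of_realD)
qed

section \<open>The semi-inner product of the invariant state\<close>

definition ip :: "'a \<Rightarrow> 'a \<Rightarrow> complex" where "ip a b = phi (st a * b)"
definition nsq :: "'a \<Rightarrow> real" where "nsq a = Re (ip a a)"

lemma ip_add_left: "ip (a + b) c = ip a c + ip b c"
  and ip_add_right: "ip a (b + c) = ip a b + ip a c"
  and ip_diff_left: "ip (a - b) c = ip a c - ip b c"
  and ip_diff_right: "ip a (b - c) = ip a b - ip a c"
  and ip_sm_left: "ip (sm z a) b = cnj z * ip a b"
  and ip_sm_right: "ip a (sm z b) = z * ip a b"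
  by (simp_all add: ip_def st_add st_diff st_sm phi_add phi_diff phi_sm
    mult_sm_left mult_sm_right algebra_simps)

lemma ip_sum_left: "ip (\<Sum>i\<in>I. f i) c = (\<Sum>i\<in>I. ip (f i) c)"
  and ip_sum_right: "ip c (\<Sum>i\<in>I. f i) = (\<Sum>i\<in>I. ip c (f i))"
  by (simp_all add: ip_def st_sum phi_sum sum_distrib_left sum_distrib_right)

lemma ip_commute: "ip b a = cnj (ip a b)"
  by (simp add: ip_def st_mult st_st flip: phi_st)

lemma ip_self: "ip a a = of_real (nsq a)"
  unfolding ip_def nsq_def by (rule phi_sa) (simp add: st_mult st_st)

lemma nsq_nonneg [simp]: "0 \<le> nsq a"
  unfolding nsq_def ip_def by (intro Re_phi_nonneg pos_st_mult)

lemma nsq_le: "nsq a \<le> (norm a)\<^sup>2"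
  unfolding nsq_def ip_def
  using complex_Re_le_cmod[of "phi (st a * a)"] cmod_phi_le[of "st a * a"] by (simp add: norm_st_mult)

lemma nsq_diff_sm: "nsq (a - sm w b) = nsq a - 2 * Re (w * ip a b) + (cmod w)\<^sup>2 * nsq b"
proof -
  have "ip (a - sm w b) (a - sm w b) = ip a a - w * ip a b - cnj (w * ip a b) + (w * cnj w) * ip b b"
    by (simp add: ip_diff_left ip_diff_right ip_sm_left ip_sm_right ip_commute[of b a] algebra_simps)
  also have "w * cnj w = of_real ((cmod w)\<^sup>2)" by (rule complex_norm_square[symmetric])
  finally show ?thesis by (simp add: nsq_def)
qed

lemma cmod_ip_le:
  assumes "nsq a \<le> r\<^sup>2" "nsq b \<le> 1" "0 \<le> r"
  shows "cmod (ip a b) \<le> r"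
proof (rule field_le_epsilon)
  fix e :: real assume e: "e > 0"
  \<comment> \<open>Enlarging \<open>r\<close> to \<open>s > 0\<close> permits division by
    \<open>s\<close> even when \<open>r = 0\<close>. The phase \<open>w\<close> chosen below turns
    \<open>z\<close> into its modulus.\<close>
  define s z where "s = r + e" and "z = ip a b"
  have s: "s > 0" using assms(3) e by (auto simp: s_def)
  have "r\<^sup>2 \<le> s\<^sup>2" using assms(3) e by (intro power_mono) (auto simp: s_def)
  then have na: "nsq a \<le> s\<^sup>2" using assms(1) by linarith
  obtain w where w: "cmod w = 1" "w * z = of_real (cmod z)"
  proof (cases "z = 0")
    case True
    then show ?thesis using that[of 1] by simp
  next
    case False
    then have "cnj z / of_real (cmod z) * z = of_real (cmod z)"
      using complex_norm_square[of z] by (simp add: field_simps power2_eq_square)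
    then show ?thesis using that[of "cnj z / of_real (cmod z)"] False by (simp add: norm_divide)
  qed
  have "0 \<le> nsq (a - sm (of_real s * w) b)" by simp
  also have "\<dots> = nsq a - 2 * s * cmod z + s\<^sup>2 * nsq b"
    unfolding nsq_diff_sm z_def[symmetric] mult.assoc w(2) using w(1) s
    by (simp add: norm_mult power_mult_distrib flip: of_real_mult)
  also have "\<dots> \<le> s\<^sup>2 - 2 * s * cmod z + s\<^sup>2 * 1"
    using mult_left_mono[OF assms(2), of "s\<^sup>2"] na by simp
  finally have "s * cmod z \<le> s * s" by (simp add: power2_eq_square)
  then show "cmod (ip a b) \<le> r + e" using s by (simp add: z_def s_def)
qed

lemma nsq_add_le: "nsq (a + b) \<le> 2 * nsq a + 2 * nsq b"
proof -
  have "nsq (a + b) + nsq (a - b) = 2 * nsq a + 2 * nsq b"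
    unfolding nsq_def by (simp add: ip_add_left ip_add_right ip_diff_left ip_diff_right)
  then show ?thesis using nsq_nonneg[of "a - b"] by linarith
qed

end

section \<open>Local means and the Bessel inequality\<close>

text \<open>A mean over a sublist is a mean over the full list against a normalized indicator. In
  this form it can be paired with functions that are orthonormal over the full list.\<close>

lemma list_mean_filter:
  assumes "filter P ys \<noteq> []"
  shows "list_mean ys (\<lambda>y. (if P y then real (length ys) / real (length (filter P ys)) else 0) *\<^sub>R F y) =
    list_mean (filter P ys) F"
proof -
  have "(\<Sum>y\<leftarrow>ys. (if P y then c else 0) *\<^sub>R F y) = c *\<^sub>R (\<Sum>y\<leftarrow>filter P ys. F y)" for c
    by (induction ys) (simp_all add: scaleR_add_right)
  moreover have "ys \<noteq> []" using assms by auto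
  ultimately show ?thesis by (simp add: list_mean_def)
qed

text \<open>Pigeonhole on rounded coordinates. The net is taken inside \<open>E\<close> by
  \<open>inv_into\<close>, because its points must themselves be Lipschitz elements later.\<close>

lemma finite_coordinate_net:
  fixes c :: "'x \<Rightarrow> nat \<Rightarrow> complex"
  assumes C: "\<And>a k. a \<in> E \<Longrightarrow> k < K \<Longrightarrow> cmod (c a k) \<le> C" and e: "e > 0"
  obtains F where "finite F" "F \<subseteq> E" "\<And>a. a \<in> E \<Longrightarrow> \<exists>b\<in>F. \<forall>k<K. cmod (c a k - c b k) \<le> e"
proof -
  have "\<forall>d>0. \<exists>Z. finite Z \<and> cball (0::complex) C \<subseteq> (\<Union>z\<in>Z. ball z d)"
    using compact_cball[of "0::complex" C] unfolding compact_eq_totally_bounded by blast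
  from this[rule_format, of "e/2"] e
  obtain Z :: "complex set" where Z: "finite Z" "cball 0 C \<subseteq> (\<Union>z\<in>Z. ball z (e/2))" by auto
  have "\<exists>z. z \<in> Z \<and> dist z (c a k) < e/2" if "a \<in> E" "k < K" for a k
    using Z(2) C[OF that] by (auto simp: subset_iff)
  then obtain z where z: "\<And>a k. a \<in> E \<Longrightarrow> k < K \<Longrightarrow> z a k \<in> Z \<and> dist (z a k) (c a k) < e/2"
    by metis
  define g where "g a = restrict (z a) {..<K}" for a
  have "g ` E \<subseteq> PiE {..<K} (\<lambda>_. Z)" using z unfolding g_def image_subset_iff restrict_PiE_iff by simp
  then have fin: "finite (g ` E)" by (rule finite_subset) (simp add: finite_PiE Z)
  show thesis
  proof (rule that[of "inv_into E g ` g ` E"])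
    fix a assume a: "a \<in> E"
    define b where "b = inv_into E g (g a)"
    have b: "b \<in> E" "g b = g a"
      using a by (auto simp: b_def inv_into_into f_inv_into_f)
    have "cmod (c a k - c b k) \<le> e" if k: "k < K" for k
    proof -
      have "z b k = z a k" using fun_cong[OF b(2), of k] k by (simp add: g_def)
      then have "dist (c a k) (c b k) < e/2 + e/2"
        using z[OF a k] z[OF b(1) k] by (intro dist_triangle_less_add[of _ "z a k"]) (auto simp: dist_commute)
      then show ?thesis by (simp add: dist_norm)
    qed
    then show "\<exists>b\<in>inv_into E g ` g ` E. \<forall>k<K. cmod (c a k - c b k) \<le> e"
      using a unfolding b_def by blast
  qed (use fin in \<open>auto simp: inv_into_into\<close>)
qed

context ergodic_action begin

lemma l_nonneg: "0 \<le> l x"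
  and l_plus: "l (x + y) \<le> l x + l y"
  and l_minus: "l (- x) = l x"
  and l_eq_0: "l x = 0 \<longleftrightarrow> x = 0"
  and continuous_on_l: "continuous_on UNIV l"
  using length_function by (auto simp: continuous_length_function_def)

lemma l_bounded:
  obtains C where "C \<ge> 0" "\<And>x. l x \<le> C"
proof -
  have "compact (range l)"
    by (intro compact_continuous_image continuous_on_l compact_UNIV_group)
  then have "bdd_above (range l)" by (intro bounded_imp_bdd_above compact_imp_bounded)
  then obtain C where C: "\<And>x. l x \<le> C" by (auto simp: bdd_above_def)
  show thesis using order_trans[OF l_nonneg C] C by (rule that)
qed

lemma group_net:
  assumes "r > 0"
  obtains Q where "finite Q" "\<And>y. \<exists>p\<in>Q. l (- p + y) < r"
proof -
  define W where "W p = {y. l (- p + y) < r}" for p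
  have cont: "continuous_on UNIV (\<lambda>y. l (- p + y))" for p
  proof -
    have "continuous_on UNIV (\<lambda>y. fst (- p, y) + snd (- p, y))"
      using compact_group unfolding compact_group_def
      by (intro continuous_on_compose2[of UNIV "\<lambda>p. fst p + snd p" UNIV "\<lambda>y. (- p, y)"] continuous_intros) auto
    then show ?thesis by (intro continuous_on_compose2[OF continuous_on_l]) auto
  qed
  have "open (W p)" for p unfolding W_def by (intro open_Collect_less cont continuous_intros)
  moreover have "UNIV \<subseteq> (\<Union>p\<in>UNIV. W p)"
    using assms l_eq_0[of 0] by (auto simp: W_def intro!: exI[where P = "\<lambda>p. l (- p + _) < r"])
  ultimately obtain Q where "finite Q" "UNIV \<subseteq> (\<Union>p\<in>Q. W p)"
    using compactE_image[OF compact_UNIV_group, of UNIV W] by auto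
  then show thesis by (intro that[of Q]) (auto simp: W_def)
qed

definition local_part :: "real \<Rightarrow> 'g list \<Rightarrow> 'g list" where
  "local_part r ys = filter (\<lambda>y. l y < r) ys"

text \<open>By pigeonhole, some left translate of a given mean has a uniformly bounded below part of
  its mass near the identity.\<close>

lemma exists_good_local:
  assumes r: "r > 0"
  obtains N where "N \<ge> 1" 
    "\<And>A e. finite A \<Longrightarrow> e > 0 \<Longrightarrow> \<exists>ys. (\<forall>a\<in>A. good ys e a) \<and> local_part r ys \<noteq> [] \<and>
      real (length ys) \<le> N * real (length (local_part r ys))"
proof -
  obtain Q where Q: "finite Q" "\<And>y. \<exists>p\<in>Q. l (- p + y) < r" using group_net[OF r] by blast
  have "Q \<noteq> {}" using Q(2)[of 0] by auto
  show thesis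
  proof (rule that[of "real (card Q)"])
    show "real (card Q) \<ge> 1" using Q(1) \<open>Q \<noteq> {}\<close> by (simp add: Suc_le_eq card_gt_0_iff)
    fix A :: "'a set" and e :: real assume "finite A" "e > 0"
    then obtain ys where ys: "ys \<noteq> []" "\<And>a. a \<in> A \<Longrightarrow> good ys e a"
      using exists_good[of A e] by metis
    define F where "F p = length (filter (\<lambda>y. l (- p + y) < r) ys)" for p
    have "length ys \<le> (\<Sum>p\<in>Q. F p)"
      unfolding F_def
    proof (induction ys)
      case (Cons y ys)
      obtain p where p: "p \<in> Q" "l (- p + y) < r" using Q by blast
      have "Suc 0 \<le> (\<Sum>p\<in>Q. if l (- p + y) < r then 1 else 0)"
        using p Q(1) member_le_sum[of p Q "\<lambda>p. if l (- p + y) < r then 1 else (0::nat)"] by simp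
      with Cons have "length (y # ys) \<le> (\<Sum>p\<in>Q. (if l (- p + y) < r then 1 else 0) + length (filter (\<lambda>y. l (- p + y) < r) ys))"
        by (simp only: sum.distrib list.size)
      also have "\<dots> = (\<Sum>p\<in>Q. length (filter (\<lambda>y. l (- p + y) < r) (y # ys)))"
        by (intro sum.cong) auto
      finally show ?case .
    qed simp
    have "\<exists>p\<in>Q. length ys \<le> card Q * F p"
    proof (rule ccontr)
      assume "\<not> ?thesis"
      then have lt: "\<And>p. p \<in> Q \<Longrightarrow> card Q * F p < length ys" by force
      have "card Q * (\<Sum>p\<in>Q. F p) < (\<Sum>p\<in>Q. length ys)"
        unfolding sum_distrib_left using Q(1) \<open>Q \<noteq> {}\<close> lt by (intro sum_strict_mono) auto
      also have "\<dots> = card Q * length ys" by simp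
      finally show False using \<open>length ys \<le> (\<Sum>p\<in>Q. F p)\<close> by simp
    qed
    then obtain p where p: "p \<in> Q" "length ys \<le> card Q * F p" by blast
    \<comment> \<open>Translation by \<open>- p\<close> carries the well-filled neighbourhood of
      \<open>p\<close> to the identity and preserves goodness.\<close>
    define zs where "zs = map ((+) (- p)) ys"
    have len: "length (local_part r zs) = F p"
      by (simp add: local_part_def zs_def F_def filter_map comp_def)
    have "\<forall>a\<in>A. good zs e a" unfolding zs_def using ys(2) good_shift by blast
    moreover have "F p \<noteq> 0" using p(2) ys(1) by (cases "F p") auto
    then have "local_part r zs \<noteq> []" using len by auto
    moreover have "real (length zs) \<le> real (card Q) * real (length (local_part r zs))"
      unfolding len using p(2) by (simp add: zs_def flip: of_nat_mult)
    ultimately show "\<exists>ys. (\<forall>a\<in>A. good ys e a) \<and> local_part r ys \<noteq> [] \<and>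
      real (length ys) \<le> real (card Q) * real (length (local_part r ys))" by blast
  qed
qed

lemma pos_av: "pos h \<Longrightarrow> pos (av xs h)"
  unfolding av_def by (intro pos_list_mean pos_alpha)

lemma linear_mult_left: "linear (\<lambda>x. x * d)" and linear_mult_right: "linear (\<lambda>x. d * x)" for d :: 'a
  by (auto intro!: linearI simp: distrib_left distrib_right)

text \<open>The difference is the variance of the orbit, the mean of
  \<open>(X - T) * st (X - T)\<close> for \<open>X = \<alpha> y c\<close> and \<open>T\<close> its
  mean: an operator form of the Cauchy-Schwarz inequality.\<close>

lemma pos_av_variance:
  assumes "vs \<noteq> []" shows "pos (av vs (c * st c) - av vs c * st (av vs c))"
proof -
  define T where "T = av vs c"
  have "list_mean vs (\<lambda>y. (\<alpha> y c - T) * st (\<alpha> y c - T)) =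
    list_mean vs (\<lambda>y. \<alpha> y (c * st c) - \<alpha> y c * st T - T * \<alpha> y (st c) + T * st T)"
    by (intro list_mean_cong) (simp add: st_diff alpha_mult alpha_st algebra_simps)
  also have "\<dots> = av vs (c * st c) - T * st T - T * av vs (st c) + T * st T"
    using assms
    by (simp add: list_mean_add list_mean_diff av_def T_def
        linear_list_mean[OF linear_mult_left, symmetric] linear_list_mean[OF linear_mult_right, symmetric])
  also have "\<dots> = av vs (c * st c) - T * st T" by (simp add: av_st T_def)
  finally have "pos (av vs (c * st c) - T * st T) \<longleftrightarrow> pos (list_mean vs (\<lambda>y. (\<alpha> y c - T) * st (\<alpha> y c - T)))"
    by (simp only:)
  then show ?thesis
    unfolding T_def[symmetric] by (simp add: pos_list_mean pos_mult_st)
qed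

text \<open>Dropping positive summands only decreases a sum, so the local mean is at most the length
  ratio times the full mean, and the latter is at most \<open>phi h + e\<close>.\<close>

lemma pos_local_bound:
  assumes h: "pos h" and good: "good ys e h" and ne: "local_part r ys \<noteq> []"
    and N: "real (length ys) \<le> N * real (length (local_part r ys))"
  shows "pos (of_real (N * (Re (phi h) + e)) - av (local_part r ys) h)"
proof -
  let ?vs = "local_part r ys"
  define us where "us = filter (\<lambda>y. \<not> l y < r) ys"
  define t where "t = Re (phi h) + e"
  have ys: "ys \<noteq> []" using good by (simp add: good_def)
  have v: "real (length ?vs) > 0" using ne by simp
  have "N * real (length ?vs) > 0" using N ys by (meson length_greater_0_conv of_nat_0_less_iff less_le_trans)
  then have N0: "N > 0" using v by (simp add: zero_less_mult_iff)
  have "cmod (phi h) = \<bar>Re (phi h)\<bar>" using phi_sa[OF pos_sa[OF h]] by (metis norm_of_real)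
  then have "cmod (phi h) = Re (phi h)" using Re_phi_nonneg[OF h] by simp
  then have "norm (av ys h) \<le> t"
    using goodD[OF good] norm_triangle_ineq[of "av ys h - sm (phi h) 1" "sm (phi h) 1"]
    by (simp add: norm_sm_1 t_def)
  then have 1: "pos (N *\<^sub>R (of_real t - av ys h))"
    using N0 h by (intro pos_scaleR pos_of_norm_le) (auto intro: pos_sa pos_av)
  have split: "(\<Sum>y\<leftarrow>ys. \<alpha> y h) = (\<Sum>y\<leftarrow>?vs. \<alpha> y h) + (\<Sum>y\<leftarrow>us. \<alpha> y h)"
    unfolding local_part_def us_def by (induction ys) (auto simp: algebra_simps)
  have "(real (length ys) / real (length ?vs)) *\<^sub>R av ys h - av ?vs h = (1 / real (length ?vs)) *\<^sub>R (\<Sum>y\<leftarrow>us. \<alpha> y h)"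
    using ys by (simp add: av_def list_mean_def split scaleR_add_right)
  also have "pos \<dots>" using h by (intro pos_scaleR pos_sum_list pos_alpha) auto
  finally have 2: "pos ((real (length ys) / real (length ?vs)) *\<^sub>R av ys h - av ?vs h)" .
  have 3: "pos ((N - real (length ys) / real (length ?vs)) *\<^sub>R av ys h)"
    using N v h by (intro pos_scaleR pos_av) (simp_all add: field_simps)
  show ?thesis
    using pos_add[OF pos_add[OF 1 2] 3]
    by (simp add: t_def algebra_simps of_real_def)
qed

text \<open>Local averaging turns a seminorm bound into a norm bound. The adjoint in
  \<open>nsq (st c)\<close> stems from the order of factors in \<open>c * st c\<close>, chosen to
  match the quantity that \<open>sum_nsq_local_av_le\<close> controls.\<close>

lemma norm_local_av:
  assumes good: "good ys e (c * st c)" and ne: "local_part r ys \<noteq> []"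
    and N: "real (length ys) \<le> N * real (length (local_part r ys))"
  shows "(norm (av (local_part r ys) c))\<^sup>2 \<le> N * (nsq (st c) + e)"
proof -
  let ?vs = "local_part r ys"
  have "pos (of_real (N * (Re (phi (c * st c)) + e)) - av ?vs (c * st c))"
    by (intro pos_local_bound pos_mult_st assms)
  from pos_add[OF this pos_av_variance[OF ne, of c]]
  have "pos (of_real (N * (Re (phi (c * st c)) + e)) - av ?vs c * st (av ?vs c))" by simp
  then have "norm (av ?vs c * st (av ?vs c)) \<le> N * (Re (phi (c * st c)) + e)"
    by (intro norm_le_of_pos_le pos_mult_st)
  then show ?thesis by (simp add: norm_mult_st nsq_def ip_def st_st)
qed

definition lip_ball :: "'a set" where
  "lip_ball = {a. st a = a \<and> (\<forall>x. norm (\<alpha> x a - a) \<le> l x)}"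

lemma norm_local_av_diff:
  assumes "a \<in> lip_ball" "local_part r ys \<noteq> []"
  shows "norm (av (local_part r ys) a - a) \<le> r"
proof (rule norm_av_diff_le[OF assms(2)])
  fix x assume "x \<in> set (local_part r ys)"
  then have "l x < r" by (simp add: local_part_def)
  moreover have "norm (\<alpha> x a - a) \<le> l x" using assms by (simp add: lip_ball_def)
  ultimately show "norm (\<alpha> x a - a) \<le> r" by simp
qed

text \<open>With \<open>T\<close> the local mean,
  \<open>a - b = T (a - b) - (T a - a) + (T b - b)\<close>. The first term is at most
  \<open>2 r\<close> by \<open>norm_local_av\<close>, each of the others at most \<open>r\<close> by
  the Lipschitz condition.\<close>

lemma norm_le_of_nsq_small:
  assumes "r > 0"
  obtains N where "N \<ge> 1"
    "\<And>a b. a \<in> lip_ball \<Longrightarrow> b \<in> lip_ball \<Longrightarrow> N * nsq (a - b) \<le> r\<^sup>2 \<Longrightarrow> norm (a - b) \<le> 4 * r"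
proof -
  obtain N where N: "N \<ge> 1"
    "\<And>A e. finite A \<Longrightarrow> e > 0 \<Longrightarrow> \<exists>ys. (\<forall>a\<in>A. good ys e a) \<and> local_part r ys \<noteq> [] \<and>
      real (length ys) \<le> N * real (length (local_part r ys))"
    using exists_good_local[OF assms] by blast
  show thesis
  proof (rule that[OF N(1)])
    fix a b assume ab: "a \<in> lip_ball" "b \<in> lip_ball" "N * nsq (a - b) \<le> r\<^sup>2"
    define c where "c = a - b"
    have sc: "st c = c" using ab by (simp add: c_def lip_ball_def st_diff)
    obtain ys where ys: "good ys (r\<^sup>2 / N) (c * st c)" "local_part r ys \<noteq> []"
      "real (length ys) \<le> N * real (length (local_part r ys))"
      using N(2)[of "{c * st c}" "r\<^sup>2 / N"] N(1) assms by auto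
    have "(norm (av (local_part r ys) c))\<^sup>2 \<le> N * (nsq c + r\<^sup>2 / N)"
      using norm_local_av[OF ys] sc by simp
    also have "\<dots> = N * nsq c + r\<^sup>2" using N(1) by (simp add: algebra_simps)
    also have "\<dots> \<le> 4 * r\<^sup>2" using ab(3) zero_le_power2[of r] unfolding c_def by linarith
    also have "4 * r\<^sup>2 = (2 * r)\<^sup>2" by (simp add: power_mult_distrib)
    finally have 1: "norm (av (local_part r ys) c) \<le> 2 * r"
      by (rule power2_le_imp_le) (use assms in simp)
    have eq: "a - b = av (local_part r ys) c - (av (local_part r ys) a - a) + (av (local_part r ys) b - b)"
      by (simp add: c_def linear_diff[OF linear_av])
    show "norm (a - b) \<le> 4 * r"
      unfolding eq
      using norm_local_av_diff[OF ab(1) ys(2)] norm_local_av_diff[OF ab(2) ys(2)] 1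
        norm_triangle_ineq[of "av (local_part r ys) c - (av (local_part r ys) a - a)" "av (local_part r ys) b - b"]
        norm_triangle_ineq4[of "av (local_part r ys) c" "av (local_part r ys) a - a"] by linarith
  qed
qed

definition orthonormal :: "nat \<Rightarrow> (nat \<Rightarrow> 'a) \<Rightarrow> bool" where
  "orthonormal K e \<longleftrightarrow> (\<forall>j<K. \<forall>k<K. ip (e j) (e k) = (if j = k then 1 else 0))"

text \<open>Bessel's inequality in the module of \<open>A\<close>-valued functions on the group: there the functions
  \<open>y \<mapsto> \<alpha> y (e k)\<close> are orthonormal because the mean of \<open>\<alpha> y (st (e j) * e k)\<close> is scalar.
  It is tested against a normalized indicator function of a neighbourhood of the identity.\<close>

lemma sum_nsq_local_av_le:
  assumes on: "orthonormal K e" and d: "d \<ge> 0"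
    and good: "\<And>j k. j < K \<Longrightarrow> k < K \<Longrightarrow> good ys d (st (e j) * e k)"
    and ne: "local_part r ys \<noteq> []"
    and N: "real (length ys) \<le> N * real (length (local_part r ys))"
  shows "(\<Sum>k<K. nsq (av (local_part r ys) (st (e k)))) \<le> N + d * (\<Sum>k<K. norm (e k))\<^sup>2"
proof -
  let ?vs = "local_part r ys"
  define n where "n = real (length ys) / real (length ?vs)"
  have v: "real (length ?vs) > 0" using ne by simp
  have n: "n \<le> N" using N v by (simp add: n_def field_simps)
  have ys: "ys \<noteq> []" using ne by (auto simp: local_part_def)
  \<comment> \<open>The test function: an indicator normalized to mean 1 over \<open>ys\<close>, so
    that its square has mean \<open>n\<close>.\<close>
  define g where "g y = (if l y < r then n else 0)" for y
  have mean_g: "list_mean ys (\<lambda>y. g y *\<^sub>R F y) = list_mean ?vs F" for F :: "'g \<Rightarrow> 'a"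
    unfolding g_def n_def local_part_def
    by (rule list_mean_filter) (use ne in \<open>simp add: local_part_def\<close>)
  \<comment> \<open>\<open>f k\<close> is the module inner product of
    \<open>y \<mapsto> \<alpha> y (e k)\<close> with \<open>g\<close>. So \<open>Z\<close> is the
    approximate projection of \<open>g\<close> and \<open>Y\<close> below the remainder;
    \<open>R\<close> collects the defect of orthonormality, since means over \<open>ys\<close> are
    scalar only up to \<open>d\<close>.\<close>
  define f where "f k = av ?vs (st (e k))" for k
  define Z where "Z y = (\<Sum>k<K. \<alpha> y (e k) * f k)" for y
  define S where "S = (\<Sum>k<K. st (f k) * f k)"
  define err where "err j k = av ys (st (e j) * e k) - sm (phi (st (e j) * e k)) 1" for j k
  define R where "R = (\<Sum>j<K. \<Sum>k<K. st (f j) * err j k * f k)"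
  have S: "st S = S" by (simp add: S_def st_sum st_mult st_st)
  have mZ: "list_mean ?vs Z = S"
    unfolding Z_def S_def list_mean_sum
    by (simp add: linear_list_mean[OF linear_mult_left, symmetric] f_def av_st st_st) (simp add: av_def)
  have mZ': "list_mean ?vs (\<lambda>y. st (Z y)) = S"
    using mZ S by (simp add: linear_list_mean[OF st_linear, symmetric])
  have mg: "list_mean ys (\<lambda>y. g y *\<^sub>R of_real (g y)) = (of_real n :: 'a)"
  proof -
    have "list_mean ?vs (\<lambda>y. of_real (g y)) = list_mean ?vs (\<lambda>y. of_real n :: 'a)"
      by (intro list_mean_cong) (auto simp: g_def local_part_def)
    then show ?thesis using ne by (simp add: mean_g)
  qed
  have mZZ: "list_mean ys (\<lambda>y. st (Z y) * Z y) = S + R"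
  proof -
    have "st (Z y) * Z y = (\<Sum>j<K. \<Sum>k<K. st (f j) * \<alpha> y (st (e j) * e k) * f k)" for y
      by (simp add: Z_def st_sum st_mult sum_product alpha_mult alpha_st mult.assoc)
    then have "list_mean ys (\<lambda>y. st (Z y) * Z y) = (\<Sum>j<K. \<Sum>k<K. st (f j) * av ys (st (e j) * e k) * f k)"
      by (simp add: list_mean_sum av_def linear_list_mean[OF linear_mult_left, symmetric]
          linear_list_mean[OF linear_mult_right, symmetric])
    also have "\<dots> = (\<Sum>j<K. \<Sum>k<K. (if j = k then st (f j) * f k else 0) + st (f j) * err j k * f k)"
    proof (intro sum.cong refl)
      fix j k assume jk: "j \<in> {..<K}" "k \<in> {..<K}"
      have "av ys (st (e j) * e k) = (if j = k then 1 else 0) + err j k"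
        using on jk unfolding err_def orthonormal_def ip_def by (simp add: sm_1 sm_of_real[of 0, simplified])
      then show "st (f j) * av ys (st (e j) * e k) * f k = (if j = k then st (f j) * f k else 0) + st (f j) * err j k * f k"
        by (simp add: distrib_left distrib_right)
    qed
    also have "\<dots> = S + R"
      by (simp add: sum.distrib S_def R_def)
    finally show ?thesis .
  qed
  define Y where "Y y = of_real (g y) - Z y" for y
  have "list_mean ys (\<lambda>y. st (Y y) * Y y) =
    list_mean ys (\<lambda>y. g y *\<^sub>R of_real (g y) - g y *\<^sub>R Z y - g y *\<^sub>R st (Z y) + st (Z y) * Z y)"
    by (intro list_mean_cong) (simp add: Y_def st_diff algebra_simps of_real_def st_scaleR)
  also have "\<dots> = of_real n - S - S + (S + R)"
    by (simp only: list_mean_add list_mean_diff mg mean_g mZ mZ' mZZ)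
  finally have "pos (of_real n - S - S + (S + R)) \<longleftrightarrow> pos (list_mean ys (\<lambda>y. st (Y y) * Y y))"
    by (simp only:)
  moreover have "pos (list_mean ys (\<lambda>y. st (Y y) * Y y))"
    by (intro pos_list_mean pos_st_mult)
  ultimately have "pos (of_real n - S - S + (S + R))" by (simp only:)
  then have "0 \<le> Re (phi (of_real n - S - S + (S + R)))" by (rule Re_phi_nonneg)
  also have "\<dots> = n - Re (phi S) + Re (phi R)" by (simp add: phi_add phi_diff)
  also have "Re (phi S) = (\<Sum>k<K. nsq (f k))" by (simp add: S_def phi_sum nsq_def ip_def)
  finally have 1: "(\<Sum>k<K. nsq (f k)) \<le> n + Re (phi R)" by simp
  have "norm R \<le> (\<Sum>j<K. \<Sum>k<K. norm (e j) * d * norm (e k))"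
    unfolding R_def
  proof (intro sum_norm_le order_trans[OF norm_sum sum_mono])
    fix j k assume jk: "j \<in> {..<K}" "k \<in> {..<K}"
    have f: "norm (f k) \<le> norm (e k)" for k using norm_av_le[OF ne, of "st (e k)"] by (simp add: f_def)
    have "norm (err j k) \<le> d" using goodD[OF good] jk by (simp add: err_def)
    then show "norm (st (f j) * err j k * f k) \<le> norm (e j) * d * norm (e k)"
      using d f by (intro order_trans[OF norm_mult_ineq] mult_mono) auto
  qed
  also have "\<dots> = d * (\<Sum>k<K. norm (e k))\<^sup>2"
    by (simp add: power2_eq_square sum_product sum_distrib_left mult_ac)
  finally have "Re (phi R) \<le> d * (\<Sum>k<K. norm (e k))\<^sup>2"
    using complex_Re_le_cmod[of "phi R"] cmod_phi_le[of R] by linarith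
  then show ?thesis using 1 n by (simp add: f_def)
qed

section \<open>Total boundedness of the Lipschitz ball\<close>


text \<open>Invariance of \<open>phi\<close> moves \<open>\<alpha> u\<close> from \<open>e\<close>,
  which is controlled only in the seminorm, onto the Lipschitz element \<open>a\<close>;
  Cauchy-Schwarz does the rest.\<close>

lemma phi_mult_av_close:
  assumes a: "a \<in> lip_ball" and e: "nsq e \<le> 1" and us: "us \<noteq> []" "\<And>u. u \<in> set us \<Longrightarrow> l u \<le> r"
  shows "cmod (phi (a * av us e) - phi (a * e)) \<le> r"
proof -
  have "cmod (phi (a * \<alpha> u e) - phi (a * e)) \<le> r" if u: "u \<in> set us" for u
  proof -
    define d where "d = \<alpha> (- u) a - a"
    have "st d = d" using a by (simp add: d_def st_diff lip_ball_def flip: alpha_st)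
    have "norm d \<le> l (- u)" using a by (simp add: d_def lip_ball_def)
    then have "norm d \<le> r" using us(2)[OF u] by (simp add: l_minus)
    then have "(norm d)\<^sup>2 \<le> r\<^sup>2" "0 \<le> r" by (auto intro: power_mono order_trans[OF norm_ge_zero])
    then have "nsq d \<le> r\<^sup>2" using nsq_le[of d] by linarith
    then have "cmod (ip d e) \<le> r" using e \<open>0 \<le> r\<close> by (rule cmod_ip_le)
    moreover have "phi (a * \<alpha> u e) = phi (\<alpha> (- u) a * e)"
      using phi_alpha[of "- u" "a * \<alpha> u e"] by (simp add: alpha_mult)
    ultimately show ?thesis
      by (simp add: ip_def \<open>st d = d\<close>) (simp add: d_def left_diff_distrib phi_diff)
  qed
  moreover have "phi (a * av us e) - phi (a * e) = list_mean us (\<lambda>u. phi (a * \<alpha> u e) - phi (a * e))"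
    using us(1) by (simp add: list_mean_diff av_def linear_list_mean[OF linear_mult_right]
        linear_list_mean[OF linear_phi])
  ultimately show ?thesis using us(1) by (simp only:) (intro norm_list_mean_le)
qed

text \<open>The local averaging operator is Hilbert-Schmidt and almost fixes the elements of \<open>lip_ball\<close>.\<close>

lemma orthonormal_bound:
  assumes d: "d > 0" and C: "C \<ge> 0"
  obtains B where "\<And>K e. orthonormal K e \<Longrightarrow>
    (\<And>k. k < K \<Longrightarrow> \<exists>a\<in>lip_ball. norm a \<le> C \<and> d \<le> cmod (ip (e k) a)) \<Longrightarrow> real K \<le> B"
proof -
  \<comment> \<open>Two successive local means change a pairing by at most
    \<open>2 r = d / 2\<close>, which leaves \<open>d / 2\<close> of the given
    \<open>d\<close>.\<close>
  define r where "r = d / 4"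
  have r: "r > 0" using d by (simp add: r_def)
  obtain N where N: "N \<ge> 1"
    "\<And>A e. finite A \<Longrightarrow> e > 0 \<Longrightarrow> \<exists>ys. (\<forall>a\<in>A. good ys e a) \<and> local_part r ys \<noteq> [] \<and>
      real (length ys) \<le> N * real (length (local_part r ys))"
    using exists_good_local[OF r] by blast
  show thesis
  proof (rule that)
    fix K e
    assume on: "orthonormal K e"
      and ex: "\<And>k. k < K \<Longrightarrow> \<exists>a\<in>lip_ball. norm a \<le> C \<and> d \<le> cmod (ip (e k) a)"
    \<comment> \<open>Chosen so that the defect term in Bessel's inequality is at most 1.\<close>
    define t where "t = 1 / ((\<Sum>k<K. norm (e k))\<^sup>2 + 1)"
    have s: "(\<Sum>k<K. norm (e k))\<^sup>2 + 1 > 0" by (simp add: add_nonneg_pos)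
    then have t: "t > 0" "t * (\<Sum>k<K. norm (e k))\<^sup>2 \<le> 1" by (simp_all add: t_def)
    define A where "A = (\<lambda>(j, k). st (e j) * e k) ` ({..<K} \<times> {..<K})"
    have "finite A" by (simp add: A_def)
    then obtain ys where ys: "\<And>a. a \<in> A \<Longrightarrow> good ys t a" "local_part r ys \<noteq> []"
      "real (length ys) \<le> N * real (length (local_part r ys))"
      using N(2)[of A t] t(1) by metis
    let ?vs = "local_part r ys"
    have good: "good ys t (st (e j) * e k)" if "j < K" "k < K" for j k
      using that by (intro ys(1)) (auto simp: A_def)
    have "(\<Sum>k<K. nsq (av ?vs (st (e k)))) \<le> N + t * (\<Sum>k<K. norm (e k))\<^sup>2"
      using on less_imp_le[OF t(1)] good ys(2,3) by (rule sum_nsq_local_av_le)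
    then have sum: "(\<Sum>k<K. nsq (av ?vs (st (e k)))) \<le> N + 1" using t by linarith
    \<comment> \<open>As \<open>e k\<close> pairs to at least \<open>d\<close> with a Lipschitz
      element, two local means cannot make it small in norm. The first mean produces the summable
      quantity, the second turns it into a norm bound.\<close>
    have each: "d\<^sup>2 / 4 \<le> C\<^sup>2 * (N * (nsq (av ?vs (st (e k))) + 1 / (real K + 1)))" if k: "k < K" for k
    proof -
      obtain a where a: "a \<in> lip_ball" "norm a \<le> C" "d \<le> cmod (ip (e k) a)" using ex[OF k] by blast
      have sa: "st a = a" using a by (simp add: lip_ball_def)
      define c where "c = av ?vs (e k)"
      \<comment> \<open>The second list depends on \<open>c\<close>, hence on the first list and on
        \<open>k\<close>. The tolerance makes the errors of all \<open>k < K\<close> add up to at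
        most 1.\<close>
      obtain zs where zs: "good zs (1 / (real K + 1)) (c * st c)" "local_part r zs \<noteq> []"
        "real (length zs) \<le> N * real (length (local_part r zs))"
        using N(2)[of "{c * st c}" "1 / (real K + 1)"] by auto
      let ?ws = "local_part r zs"
      have nc: "(norm (av ?ws c))\<^sup>2 \<le> N * (nsq (av ?vs (st (e k))) + 1 / (real K + 1))"
        using norm_local_av[OF zs] by (simp add: c_def av_st)
      define us where "us = list_plus ?ws ?vs"
      have us: "us \<noteq> []" using zs ys by (simp add: us_def)
      have lu: "l u \<le> 2 * r" if u: "u \<in> set us" for u
      proof -
        obtain w v where "u = w + v" "l w < r" "l v < r"
          using u unfolding us_def list_plus_def local_part_def by auto
        then show ?thesis using l_plus[of w v] by simp
      qed
      have ne: "nsq (e k) \<le> 1" using on k by (simp add: orthonormal_def nsq_def)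
      have "cmod (phi (a * av us (e k)) - phi (a * e k)) \<le> 2 * r"
        using a(1) ne us lu by (rule phi_mult_av_close)
      moreover have "av us (e k) = av ?ws c" by (simp add: us_def c_def av_plus)
      moreover have "cmod (phi (a * av ?ws c)) \<le> C * norm (av ?ws c)"
        by (intro order_trans[OF cmod_phi_le] order_trans[OF norm_mult_ineq] mult_right_mono a) simp
      moreover have "cmod (ip (e k) a) = cmod (phi (a * e k))"
        using ip_commute[of "e k" a] by (simp add: ip_def sa)
      ultimately have "d \<le> 2 * r + C * norm (av ?ws c)"
        using a(3) norm_triangle_ineq4[of "phi (a * av us (e k))" "phi (a * av us (e k)) - phi (a * e k)"]
        by simp
      then have "d / 2 \<le> C * norm (av ?ws c)" by (simp add: r_def)
      then have "(d / 2)\<^sup>2 \<le> (C * norm (av ?ws c))\<^sup>2" using d by (intro power_mono) auto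
      also have "\<dots> \<le> C\<^sup>2 * (N * (nsq (av ?vs (st (e k))) + 1 / (real K + 1)))"
        unfolding power_mult_distrib using nc by (intro mult_left_mono) auto
      finally show ?thesis by (simp add: power_divide)
    qed
    have "real K * (d\<^sup>2 / 4) = (\<Sum>k<K. d\<^sup>2 / 4)" by simp
    also have "\<dots> \<le> (\<Sum>k<K. C\<^sup>2 * (N * (nsq (av ?vs (st (e k))) + 1 / (real K + 1))))"
      by (intro sum_mono each) auto
    also have "\<dots> = C\<^sup>2 * (N * ((\<Sum>k<K. nsq (av ?vs (st (e k)))) + real K / (real K + 1)))"
      by (simp add: sum.distrib flip: sum_distrib_left)
    also have "\<dots> \<le> C\<^sup>2 * (N * ((N + 1) + 1))"
      using sum N(1) by (intro mult_left_mono add_mono) auto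
    finally show "real K \<le> C\<^sup>2 * (N * (N + 2)) * (4 / d\<^sup>2)" using d by (simp add: field_simps)
  qed
qed

lemma nsq_scaleR: "nsq (r *\<^sub>R a) = r\<^sup>2 * nsq a"
  unfolding nsq_def ip_def by (simp add: st_scaleR phi_scaleR power2_eq_square)

lemma nsq_diff_le: "nsq (a - b) \<le> 2 * nsq a + 2 * nsq b"
  using nsq_add_le[of a "- b"] nsq_scaleR[of "- 1" b] by simp

text \<open>Orthonormal families whose members each pair to at least \<open>d\<close> with some
  element of the ball have bounded length, so some length \<open>K\<close> occurs while
  \<open>K + 1\<close> does not. A residual with seminorm above \<open>d\<close> would, once
  normalized, be a further member, witnessed by \<open>a\<close> itself.\<close>

lemma finite_almost_spanning:
  assumes d: "d > 0" and C: "C \<ge> 0"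
  obtains K e where "orthonormal K e"
    "\<And>a. a \<in> lip_ball \<Longrightarrow> norm a \<le> C \<Longrightarrow> nsq (a - (\<Sum>k<K. sm (ip (e k) a) (e k))) \<le> d\<^sup>2"
proof -
  define P where "P K \<longleftrightarrow> (\<exists>e. orthonormal K e \<and> 
    (\<forall>k<K. \<exists>a\<in>lip_ball. norm a \<le> C \<and> d \<le> cmod (ip (e k) a)))" for K
  obtain B where B: "\<And>K. P K \<Longrightarrow> real K \<le> B"
    using orthonormal_bound[OF d C] unfolding P_def by metis
  have "\<exists>K. P K \<and> \<not> P (Suc K)"
  proof (rule ccontr)
    assume "\<not> ?thesis"
    moreover have "P 0" by (simp add: P_def orthonormal_def)
    ultimately have "P K" for K by (induction K) auto
    then have "real (Suc (nat \<lceil>B\<rceil>)) \<le> B" by (rule B)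
    then show False by linarith
  qed
  then obtain K where K: "P K" "\<not> P (Suc K)" by blast
  obtain e where e: "orthonormal K e"
    "\<And>k. k < K \<Longrightarrow> \<exists>a\<in>lip_ball. norm a \<le> C \<and> d \<le> cmod (ip (e k) a)"
    using K(1) unfolding P_def by blast
  show thesis
  proof (rule that[OF e(1)], rule ccontr)
    fix a assume a: "a \<in> lip_ball" "norm a \<le> C"
    define b where "b = a - (\<Sum>k<K. sm (ip (e k) a) (e k))"
    assume "\<not> nsq (a - (\<Sum>k<K. sm (ip (e k) a) (e k))) \<le> d\<^sup>2"
    then have "d\<^sup>2 < nsq b" by (simp add: b_def)
    define s where "s = sqrt (nsq b)"
    have s: "d < s" "s * s = nsq b"
      using \<open>d\<^sup>2 < nsq b\<close> d by (auto simp: s_def real_less_rsqrt)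
    have s0: "s > 0" using s d by linarith
    have eb: "ip (e j) b = 0" if "j < K" for j
    proof -
      have "ip (e j) (\<Sum>k<K. sm (ip (e k) a) (e k)) = (\<Sum>k<K. if j = k then ip (e k) a else 0)"
        unfolding ip_sum_right ip_sm_right using e(1) that
        by (intro sum.cong) (auto simp: orthonormal_def)
      then show ?thesis using that by (simp add: b_def ip_diff_right)
    qed
    have be: "ip b (e j) = 0" if "j < K" for j
      using eb[OF that] ip_commute[of b "e j"] by simp
    define w where "w = sm (of_real (1 / s)) b"
    \<comment> \<open>The residual is orthogonal to every \<open>e k\<close>, so pairing it with
      \<open>a\<close> amounts to pairing it with itself.\<close>
    have "ip b a = ip b b + (\<Sum>k<K. ip (e k) a * ip b (e k))"
      by (simp add: b_def ip_diff_right ip_sum_right ip_sm_right)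
    then have "ip b a = of_real (s * s)" using be by (simp add: ip_self s(2))
    then have wa: "ip w a = of_real s" using s0 unfolding w_def ip_sm_left by simp
    have "ip w w = of_real (1 / s) * (of_real (1 / s) * ip b b)"
      by (simp only: w_def ip_sm_left ip_sm_right complex_cnj_complex_of_real)
    then have ww: "ip w w = 1" unfolding ip_self[of b] s(2)[symmetric] using s0 by simp
    have "orthonormal (Suc K) (e(K := w))"
      using e(1) ww eb be unfolding orthonormal_def w_def
      by (auto simp: less_Suc_eq ip_sm_left ip_sm_right)
    moreover have "\<exists>a\<in>lip_ball. norm a \<le> C \<and> d \<le> cmod (ip ((e(K := w)) k) a)" if "k < Suc K" for k
    proof (cases "k = K")
      case True
      then show ?thesis using a wa s s0 by (intro bexI[of _ a]) auto
    next
      case False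
      then show ?thesis using e(2) that by auto
    qed
    ultimately have "P (Suc K)" unfolding P_def by blast
    with K show False by blast
  qed
qed

lemma nsq_orthonormal_sum:
  assumes "orthonormal K e" shows "nsq (\<Sum>k<K. sm (c k) (e k)) = (\<Sum>k<K. (cmod (c k))\<^sup>2)"
proof -
  define q where "q = (\<Sum>k<K. sm (c k) (e k))"
  have "ip q q = (\<Sum>j<K. \<Sum>k<K. ip (sm (c j) (e j)) (sm (c k) (e k)))"
    by (simp only: q_def ip_sum_left[where c = "sum _ _"]) (simp only: ip_sum_right)
  also have "\<dots> = (\<Sum>j<K. \<Sum>k<K. if j = k then cnj (c j) * c k else 0)"
    using assms by (intro sum.cong refl) (auto simp: orthonormal_def ip_sm_left ip_sm_right)
  also have "\<dots> = (\<Sum>k<K. of_real ((cmod (c k))\<^sup>2))"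
    by (simp add: complex_norm_square mult.commute del: of_real_power)
  finally show ?thesis unfolding ip_self of_real_sum[symmetric] of_real_eq_iff q_def .
qed

lemma lip_ball_totally_bounded:
  assumes eps: "eps > 0" and C: "C \<ge> 0"
  obtains F where "finite F" "F \<subseteq> lip_ball"
    "\<And>a. a \<in> lip_ball \<Longrightarrow> norm a \<le> C \<Longrightarrow> \<exists>b\<in>F. norm (a - b) \<le> eps"
proof -
  define r where "r = eps / 4"
  have r: "r > 0" using eps by (simp add: r_def)
  obtain N where N: "N \<ge> 1"
    "\<And>a b. a \<in> lip_ball \<Longrightarrow> b \<in> lip_ball \<Longrightarrow> N * nsq (a - b) \<le> r\<^sup>2 \<Longrightarrow> norm (a - b) \<le> 4 * r"
    using norm_le_of_nsq_small[OF r] by blast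
  \<comment> \<open>This gives \<open>8 N d^2 = r^2 / (2 N)\<close> for the residuals, and
    \<open>t\<close> below gives \<open>2 N K t^2 \<le> r^2 / (2 N)\<close> for the coordinates
    because \<open>K \<le> M^2\<close>; together at most \<open>r^2\<close>.\<close>
  define d where "d = r / (4 * N)"
  have d: "d > 0" using r N(1) by (simp add: d_def)
  obtain K e where on: "orthonormal K e"
    and res: "\<And>a. a \<in> lip_ball \<Longrightarrow> norm a \<le> C \<Longrightarrow> nsq (a - (\<Sum>k<K. sm (ip (e k) a) (e k))) \<le> d\<^sup>2"
    using finite_almost_spanning[OF d C] by metis
  define E where "E = {a \<in> lip_ball. norm a \<le> C}"
  define M where "M = real K + 1"
  have M: "M > 0" "real K \<le> M\<^sup>2" by (simp_all add: M_def power2_eq_square algebra_simps)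
  define t where "t = r / (2 * N * M)"
  have t: "t > 0" using r N(1) M by (simp add: t_def)
  have coord: "cmod (ip (e k) a) \<le> C" if "a \<in> E" "k < K" for a k
  proof -
    have "(norm a)\<^sup>2 \<le> C\<^sup>2" using that by (intro power_mono) (auto simp: E_def)
    then have "nsq a \<le> C\<^sup>2" using nsq_le[of a] by linarith
    moreover have "nsq (e k) \<le> 1" using on that by (simp add: orthonormal_def nsq_def)
    ultimately have "cmod (ip a (e k)) \<le> C" using C by (rule cmod_ip_le)
    then show ?thesis using ip_commute[of "e k" a] by simp
  qed
  obtain F where F: "finite F" "F \<subseteq> E"
    "\<And>a. a \<in> E \<Longrightarrow> \<exists>b\<in>F. \<forall>k<K. cmod (ip (e k) a - ip (e k) b) \<le> t"
    using finite_coordinate_net[of E K "\<lambda>a k. ip (e k) a" C t] coord t by metis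
  show thesis
  proof (rule that[OF F(1)])
    show "F \<subseteq> lip_ball" using F(2) by (auto simp: E_def)
    fix a assume a: "a \<in> lip_ball" "norm a \<le> C"
    then obtain b where b: "b \<in> F" "\<And>k. k < K \<Longrightarrow> cmod (ip (e k) a - ip (e k) b) \<le> t"
      using F(3)[of a] by (auto simp: E_def)
    then have bE: "b \<in> lip_ball" "norm b \<le> C" using F(2) by (auto simp: E_def)
    define p where "p a = a - (\<Sum>k<K. sm (ip (e k) a) (e k))" for a
    define q where "q = (\<Sum>k<K. sm (ip (e k) a - ip (e k) b) (e k))"
    have "a - b = (p a - p b) + q"
      by (simp add: p_def q_def sm_diff_left sum_subtractf)
    then have "nsq (a - b) \<le> 2 * nsq (p a - p b) + 2 * nsq q" by (simp add: nsq_add_le)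
    also have "nsq (p a - p b) \<le> 4 * d\<^sup>2"
      using nsq_diff_le[of "p a" "p b"] res[OF a] res[OF bE] by (simp add: p_def)
    also have "nsq q \<le> (\<Sum>k<K. t\<^sup>2)"
      unfolding q_def nsq_orthonormal_sum[OF on] using b(2) by (intro sum_mono power_mono) auto
    finally have 1: "nsq (a - b) \<le> 8 * d\<^sup>2 + 2 * (real K * t\<^sup>2)" by simp
    have NN: "N \<le> N\<^sup>2" using N(1) by (simp add: power2_eq_square)
    have "N * (8 * d\<^sup>2) = (N / N\<^sup>2) * (r\<^sup>2 / 2)"
      using N(1) by (simp add: d_def power_divide power_mult_distrib)
    also have "\<dots> \<le> 1 * (r\<^sup>2 / 2)" using NN N(1) by (intro mult_right_mono) auto
    finally have 2: "N * (8 * d\<^sup>2) \<le> r\<^sup>2 / 2" by simp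
    have "N * (2 * (real K * t\<^sup>2)) = (N / N\<^sup>2) * (real K / M\<^sup>2) * (r\<^sup>2 / 2)"
      by (simp add: t_def power_divide power_mult_distrib mult_ac)
    also have "\<dots> \<le> 1 * 1 * (r\<^sup>2 / 2)"
      using NN N(1) M by (intro mult_right_mono mult_mono) auto
    finally have 3: "N * (2 * (real K * t\<^sup>2)) \<le> r\<^sup>2 / 2" by simp
    have "N * nsq (a - b) \<le> N * (8 * d\<^sup>2 + 2 * (real K * t\<^sup>2))" using 1 N(1) by (intro mult_left_mono) auto
    also have "\<dots> \<le> r\<^sup>2" using 2 3 by (simp only: distrib_left)
    finally have "norm (a - b) \<le> 4 * r" using N(2)[OF a(1) bE(1)] by blast
    then show "\<exists>b\<in>F. norm (a - b) \<le> eps" using b(1) by (auto simp: r_def)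
  qed
qed

text \<open>Means of the orbit of \<open>a\<close> stay within the bound \<open>C\<close> of
  \<open>l\<close> from \<open>a\<close> and come arbitrarily close to \<open>phi a\<close>, so
  \<open>a - phi a\<close> has norm at most \<open>C\<close>.\<close>

lemma lip_ball_totally_bounded_mod_scalars:
  assumes eps: "eps > 0"
  obtains F where "finite F" "F \<subseteq> lip_ball"
    "\<And>a. a \<in> lip_ball \<Longrightarrow> \<exists>b\<in>F. \<exists>t. norm (a - of_real t - b) \<le> eps"
proof -
  obtain C where C: "C \<ge> 0" "\<And>x. l x \<le> C" using l_bounded by blast
  obtain F where F: "finite F" "F \<subseteq> lip_ball"
    "\<And>a. a \<in> lip_ball \<Longrightarrow> norm a \<le> C \<Longrightarrow> \<exists>b\<in>F. norm (a - b) \<le> eps"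
    using lip_ball_totally_bounded[OF eps C(1)] by blast
  show thesis
  proof (rule that[OF F(1,2)])
    fix a assume a: "a \<in> lip_ball"
    define t where "t = Re (phi a)"
    have phi: "phi a = of_real t" unfolding t_def using a by (intro phi_sa) (simp add: lip_ball_def)
    have "norm (a - of_real t) \<le> C"
    proof (rule field_le_epsilon)
      fix e :: real assume e: "e > 0"
      obtain ys where ys: "good ys e a" using exists_good1[OF e] by blast
      have "norm (av ys a - a) \<le> C"
        using ys a C(2) by (intro norm_av_diff_le) (auto simp: good_def lip_ball_def intro: order_trans)
      moreover have "norm (av ys a - of_real t) \<le> e"
        using goodD[OF ys] by (simp add: phi sm_of_real_1)
      ultimately show "norm (a - of_real t) \<le> C + e"
        using norm_triangle_ineq4[of "av ys a - of_real t" "av ys a - a"] by simp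
    qed
    moreover have "a - of_real t \<in> lip_ball"
      using a by (simp add: lip_ball_def st_diff alpha_diff)
    ultimately show "\<exists>b\<in>F. \<exists>t. norm (a - of_real t - b) \<le> eps" using F(3) by blast
  qed
qed

end

section \<open>The topology on the state space\<close>

lemma openin_metric_topology_on:
  "openin (metric_topology_on S d) U \<longleftrightarrow> U \<subseteq> S \<and> (\<forall>x\<in>U. \<exists>r>0. {y\<in>S. d x y < ereal r} \<subseteq> U)"
proof -
  let ?P = "\<lambda>U. U \<subseteq> S \<and> (\<forall>x\<in>U. \<exists>r>0. {y\<in>S. d x y < ereal r} \<subseteq> U)"
  have "istopology ?P"
    unfolding istopology_def
  proof (intro conjI allI impI)
    fix U V assume U: "?P U" and V: "?P V"
    show "U \<inter> V \<subseteq> S" using U by blast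
    show "\<forall>x\<in>U \<inter> V. \<exists>r>0. {y\<in>S. d x y < ereal r} \<subseteq> U \<inter> V"
    proof
      fix x assume "x \<in> U \<inter> V"
      then obtain r s where r: "r > 0" "{y\<in>S. d x y < ereal r} \<subseteq> U" and s: "s > 0" "{y\<in>S. d x y < ereal s} \<subseteq> V"
        using U V by blast
      have "{y\<in>S. d x y < ereal (min r s)} \<subseteq> U \<inter> V"
      proof
        fix y assume y: "y \<in> {y\<in>S. d x y < ereal (min r s)}"
        then have "d x y < ereal r" "d x y < ereal s"
          by (auto elim: less_le_trans)
        then show "y \<in> U \<inter> V" using y r(2) s(2) by blast
      qed
      then show "\<exists>r>0. {y\<in>S. d x y < ereal r} \<subseteq> U \<inter> V"
        using r(1) s(1) by (intro exI[of _ "min r s"]) auto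
    qed
  next
    fix \<U> assume U: "\<forall>U\<in>\<U>. ?P U"
    then show "\<Union>\<U> \<subseteq> S" by blast
    show "\<forall>x\<in>\<Union>\<U>. \<exists>r>0. {y\<in>S. d x y < ereal r} \<subseteq> \<Union>\<U>"
      using U by (meson UnionE Sup_upper order_trans)
  qed
  then show ?thesis unfolding metric_topology_on_def by simp
qed

lemma topspace_weak_star: "topspace (weak_star_topology st D) = state_space st D"
  by (auto simp: weak_star_topology_def state_space_def PiE_def)

context ergodic_action begin

abbreviation "L \<equiv> lip_seminorm \<alpha> l"

definition lip_domain :: "'a set" where
  "lip_domain = {a. st a = a \<and> L a < \<infinity>}"

text \<open>The \<open>0\<close> inside the supremum accounts for \<open>0 \<le> c\<close>, which
  matters for the trivial group. The point \<open>x = 0\<close> can be included since both sides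
  vanish there.\<close>

lemma L_le_iff: "L a \<le> ereal c \<longleftrightarrow> 0 \<le> c \<and> (\<forall>x. norm (\<alpha> x a - a) \<le> c * l x)"
proof -
  have "L a \<le> ereal c \<longleftrightarrow> 0 \<le> c \<and> (\<forall>x. x \<noteq> 0 \<longrightarrow> norm (\<alpha> x a - a) / l x \<le> c)"
    unfolding lip_seminorm_def Sup_le_iff by auto
  also have "\<dots> \<longleftrightarrow> 0 \<le> c \<and> (\<forall>x. norm (\<alpha> x a - a) \<le> c * l x)"
  proof -
    have "(x \<noteq> 0 \<longrightarrow> norm (\<alpha> x a - a) / l x \<le> c) \<longleftrightarrow> norm (\<alpha> x a - a) \<le> c * l x" for x
    proof (cases "x = 0")
      case True
      then show ?thesis using l_eq_0[of x] by simp
    next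
      case False
      then have "l x > 0" using l_nonneg[of x] l_eq_0[of x] by linarith
      then show ?thesis using False by (simp add: pos_divide_le_eq)
    qed
    then show ?thesis by simp
  qed
  finally show ?thesis .
qed

lemma L_nonneg: "0 \<le> L a"
  unfolding lip_seminorm_def by (intro Sup_upper) simp

lemma lip_domainE:
  assumes "a \<in> lip_domain" obtains c where "c \<ge> 0" "L a = ereal c" "st a = a"
proof (cases "L a")
  case (real c)
  then show thesis using that assms L_nonneg[of a] by (auto simp: lip_domain_def)
qed (use assms L_nonneg[of a] in \<open>auto simp: lip_domain_def\<close>)

lemma lip_domainI: "st a = a \<Longrightarrow> L a \<le> ereal c \<Longrightarrow> a \<in> lip_domain"
  by (auto simp: lip_domain_def)

lemma L_add_le:
  assumes "L a \<le> ereal c" "L b \<le> ereal d" shows "L (a + b) \<le> ereal (c + d)"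
proof -
  have "norm (\<alpha> x (a + b) - (a + b)) \<le> (c + d) * l x" for x
  proof -
    have "norm (\<alpha> x (a + b) - (a + b)) \<le> norm (\<alpha> x a - a) + norm (\<alpha> x b - b)"
      using norm_triangle_ineq[of "\<alpha> x a - a" "\<alpha> x b - b"] by (simp add: alpha_add algebra_simps)
    also have "\<dots> \<le> c * l x + d * l x" using assms by (intro add_mono) (simp_all add: L_le_iff)
    finally show ?thesis by (simp add: distrib_right)
  qed
  then show ?thesis using assms by (simp add: L_le_iff)
qed

lemma L_scaleR_le:
  assumes "L a \<le> ereal c" shows "L (r *\<^sub>R a) \<le> ereal (\<bar>r\<bar> * c)"
proof -
  have "norm (\<alpha> x (r *\<^sub>R a) - r *\<^sub>R a) \<le> \<bar>r\<bar> * c * l x" for x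
  proof -
    have "norm (\<alpha> x (r *\<^sub>R a) - r *\<^sub>R a) = \<bar>r\<bar> * norm (\<alpha> x a - a)"
      by (simp add: alpha_scaleR flip: scaleR_diff_right)
    also have "\<dots> \<le> \<bar>r\<bar> * (c * l x)" using assms by (intro mult_left_mono) (simp_all add: L_le_iff)
    finally show ?thesis by simp
  qed
  then show ?thesis using assms by (simp add: L_le_iff)
qed

lemma L_of_real: "L (of_real r) \<le> ereal 0"
  by (simp add: L_le_iff)

lemma L_1: "L 1 = 0"
  using L_of_real[of 1] L_nonneg[of 1] by (simp add: zero_ereal_def)

lemma L_scaleR:
  assumes "a \<in> lip_domain" shows "L (r *\<^sub>R a) = ereal \<bar>r\<bar> * L a"
proof -
  obtain c where c: "L a = ereal c" "c \<ge> 0" using assms by (rule lip_domainE)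
  have le: "L (r *\<^sub>R a) \<le> ereal (\<bar>r\<bar> * c)" using c by (intro L_scaleR_le) simp
  obtain d where d: "L (r *\<^sub>R a) = ereal d" "d \<ge> 0"
    using le L_nonneg[of "r *\<^sub>R a"] by (cases "L (r *\<^sub>R a)") auto
  have "\<bar>r\<bar> * c \<le> d"
  proof (cases "r = 0")
    case False
    have "L ((1 / r) *\<^sub>R (r *\<^sub>R a)) \<le> ereal (\<bar>1 / r\<bar> * d)" by (rule L_scaleR_le) (simp add: d)
    then show ?thesis using False c by (simp add: field_simps abs_divide)
  qed (use d in simp)
  then show ?thesis using le d c by simp
qed

lemma lip_domain_add: "a \<in> lip_domain \<Longrightarrow> b \<in> lip_domain \<Longrightarrow> a + b \<in> lip_domain"
  by (elim lip_domainE, rule lip_domainI[OF _ L_add_le]) (auto simp: st_add)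

lemma lip_domain_scaleR: "a \<in> lip_domain \<Longrightarrow> r *\<^sub>R a \<in> lip_domain"
  by (elim lip_domainE, rule lip_domainI[OF _ L_scaleR_le]) (auto simp: st_scaleR)

lemma lip_domain_of_real: "of_real r \<in> lip_domain"
  by (rule lip_domainI[OF _ L_of_real]) simp

lemma lip_domain_diff: "a \<in> lip_domain \<Longrightarrow> b \<in> lip_domain \<Longrightarrow> a - b \<in> lip_domain"
  using lip_domain_add[of a "(- 1) *\<^sub>R b"] lip_domain_scaleR[of b "- 1"] by simp

lemma lip_ball_iff: "a \<in> lip_ball \<longleftrightarrow> a \<in> lip_domain \<and> L a \<le> 1"
  using L_le_iff[of a 1] by (auto simp: lip_ball_def lip_domain_def one_ereal_def[symmetric])

abbreviation "S \<equiv> state_space st lip_domain"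

lemma state_add: "\<mu> \<in> S \<Longrightarrow> a \<in> lip_domain \<Longrightarrow> b \<in> lip_domain \<Longrightarrow> \<mu> (a + b) = \<mu> a + \<mu> b"
  and state_scaleR: "\<mu> \<in> S \<Longrightarrow> a \<in> lip_domain \<Longrightarrow> \<mu> (r *\<^sub>R a) = r * \<mu> a"
  and state_nonneg: "\<mu> \<in> S \<Longrightarrow> st c * c \<in> lip_domain \<Longrightarrow> 0 \<le> \<mu> (st c * c)"
  and state_1: "\<mu> \<in> S \<Longrightarrow> \<mu> 1 = 1"
  and state_extensional: "\<mu> \<in> S \<Longrightarrow> \<mu> \<in> extensional lip_domain"
  by (auto simp: state_space_def cstar_positive_def)

lemma state_of_real: "\<mu> \<in> S \<Longrightarrow> \<mu> (of_real r) = r"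
  using state_scaleR[of \<mu> 1 r] lip_domain_of_real[of 1] by (simp add: of_real_def state_1)

lemma state_diff: 
  assumes "\<mu> \<in> S" "a \<in> lip_domain" "b \<in> lip_domain" shows "\<mu> (a - b) = \<mu> a - \<mu> b"
  using state_add[OF assms(1) lip_domain_diff[OF assms(2,3)] assms(3)] by simp

text \<open>Positivity of a state is demanded for those \<open>st c * c\<close> that lie in the
  domain. Here \<open>norm a + e - a\<close> lies there, while its root \<open>s\<close> need
  not.\<close>

lemma state_le_norm:
  assumes "\<mu> \<in> S" "a \<in> lip_domain" shows "\<mu> a \<le> norm a"
proof (rule field_le_epsilon)
  fix e :: real assume e: "e > 0"
  have sa: "st a = a" using assms(2) by (simp add: lip_domain_def)
  obtain s where s: "st s = s" "s * s = of_real (norm a + e) - a"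
    by (rule sqrt_near[of "of_real (norm a + e) - a" "norm a + e"])
      (use e sa in \<open>auto simp: st_diff st_add\<close>)
  have "of_real (norm a + e) - a \<in> lip_domain"
    using assms by (intro lip_domain_diff lip_domain_of_real)
  then have "0 \<le> \<mu> (of_real (norm a + e) - a)"
    using state_nonneg[of \<mu> s] assms s by simp
  then show "\<mu> a \<le> norm a + e"
    by (simp only: state_diff[OF assms(1) lip_domain_of_real assms(2)] state_of_real[OF assms(1)] diff_ge_0_iff_ge)
qed

lemma abs_state_le_norm:
  assumes "\<mu> \<in> S" "a \<in> lip_domain" shows "\<bar>\<mu> a\<bar> \<le> norm a"
  using state_le_norm[OF assms] state_le_norm[OF assms(1) lip_domain_scaleR[OF assms(2)], of "- 1"]
    state_scaleR[OF assms, of "- 1"] by simp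

text \<open>A finite net of the ball modulo scalars supplies the coordinates that define
  \<open>V\<close>. The scalars cancel because all states agree on them, and the errors add up to
  \<open>r/8 + r/4 + r/8 = r/2\<close>, which leaves room for strictness after the supremum.\<close>

lemma rho_ball_weak_nhd:
  assumes x: "x \<in> S" and r: "r > 0"
  shows "\<exists>V. openin (weak_star_topology st lip_domain) V \<and> x \<in> V \<and>
    V \<subseteq> {y \<in> S. rho_L lip_domain L x y < ereal r}"
proof -
  let ?W = "weak_star_topology st lip_domain"
  obtain F where F: "finite F" "F \<subseteq> lip_ball"
    "\<And>a. a \<in> lip_ball \<Longrightarrow> \<exists>b\<in>F. \<exists>t. norm (a - of_real t - b) \<le> r / 8"
    using lip_ball_totally_bounded_mod_scalars[of "r / 8"] r by auto
  define V where "V = (\<Inter>b\<in>F. {y \<in> topspace ?W. y b \<in> ball (x b) (r / 4)}) \<inter> topspace ?W"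
  have "openin ?W V"
    unfolding V_def
  proof (rule openin_INT[OF F(1)])
    fix b assume "b \<in> F"
    then have "b \<in> lip_domain" using F(2) lip_ball_iff by blast
    then have "continuous_map ?W euclideanreal (\<lambda>y. y b)"
      unfolding weak_star_topology_def
      by (intro continuous_map_from_subtopology continuous_map_product_projection)
    then show "openin ?W {y \<in> topspace ?W. y b \<in> ball (x b) (r / 4)}"
      by (rule openin_continuous_map_preimage) simp
  qed
  moreover have "x \<in> V" using x r by (simp add: V_def topspace_weak_star)
  moreover have "V \<subseteq> {y \<in> S. rho_L lip_domain L x y < ereal r}"
  proof
    fix y assume y: "y \<in> V"
    then have yS: "y \<in> S" by (simp add: V_def topspace_weak_star)
    have "\<bar>x a - y a\<bar> \<le> r / 2" if a: "a \<in> lip_domain" "L a \<le> 1" for a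
    proof -
      obtain b t where b: "b \<in> F" "norm (a - of_real t - b) \<le> r / 8"
        using F(3) a lip_ball_iff by blast
      have bD: "b \<in> lip_domain" using F(2) b(1) lip_ball_iff by blast
      have near: "\<bar>\<mu> a - t - \<mu> b\<bar> \<le> r / 8" if m: "\<mu> \<in> S" for \<mu>
      proof -
        have D: "a - of_real t \<in> lip_domain" using a by (intro lip_domain_diff lip_domain_of_real)
        have "\<mu> (a - of_real t - b) = \<mu> a - t - \<mu> b"
          using m a bD D by (simp add: state_diff state_of_real lip_domain_of_real)
        then show ?thesis
          using abs_state_le_norm[OF m lip_domain_diff[OF D bD]] b(2) by simp
      qed
      have "\<bar>x b - y b\<bar> < r / 4" using y b(1) by (auto simp: V_def dist_real_def)
      then show ?thesis using near[OF x] near[OF yS] by linarith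
    qed
    then have "rho_L lip_domain L x y \<le> ereal (r / 2)"
      unfolding rho_L_def by (auto intro!: Sup_least)
    also have "\<dots> < ereal r" using r by simp
    finally show "y \<in> {y \<in> S. rho_L lip_domain L x y < ereal r}" using yS by simp
  qed
  ultimately show ?thesis by blast
qed

lemma state_diff_less_of_rho:
  assumes x: "x \<in> S" and y: "y \<in> S" and a: "a \<in> lip_domain" "L a \<le> ereal c"
    and rho: "rho_L lip_domain L x y < ereal r"
  shows "\<bar>x a - y a\<bar> < (c + 1) * r"
proof -
  have c: "c \<ge> 0" using a(2) by (simp add: L_le_iff)
  \<comment> \<open>Division by \<open>c + 1\<close> rather than \<open>c\<close> covers
    \<open>c = 0\<close>.\<close>
  define b where "b = (1 / (c + 1)) *\<^sub>R a"
  have "L b \<le> ereal (\<bar>1 / (c + 1)\<bar> * c)" unfolding b_def by (rule L_scaleR_le[OF a(2)])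
  also have "\<dots> \<le> 1" using c by (simp add: one_ereal_def divide_le_eq_1)
  finally have "ereal \<bar>x b - y b\<bar> \<le> rho_L lip_domain L x y"
    unfolding rho_L_def using lip_domain_scaleR[OF a(1)] by (auto simp: b_def intro!: Sup_upper)
  then have "\<bar>x b - y b\<bar> < r" using rho by (metis ereal_less_eq(3) le_less_trans less_ereal.simps(1))
  moreover have "x b - y b = (x a - y a) / (c + 1)"
    by (simp add: b_def state_scaleR[OF x a(1)] state_scaleR[OF y a(1)] diff_divide_distrib)
  ultimately show ?thesis using c by (simp add: abs_divide divide_less_eq mult.commute)
qed

text \<open>Every coordinate \<open>a\<close> has finite \<open>L a\<close>, so \<open>rho_L\<close>
  controls it up to a factor, and a basic open set constrains only finitely many
  coordinates.\<close>

lemma weak_open_contains_rho_ball: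
  assumes U: "openin (weak_star_topology st lip_domain) U" and x: "x \<in> U"
  shows "\<exists>r>0. {y \<in> S. rho_L lip_domain L x y < ereal r} \<subseteq> U"
proof -
  have xS: "x \<in> S" using U x openin_subset topspace_weak_star by blast
  obtain T where T: "openin (product_topology (\<lambda>_. euclideanreal) lip_domain) T" "U = T \<inter> S"
    using U unfolding weak_star_topology_def openin_subtopology by blast
  then have "x \<in> T" using x by blast
  with T(1) obtain W where W: "finite {a \<in> lip_domain. W a \<noteq> UNIV}" "\<And>a. a \<in> lip_domain \<Longrightarrow> open (W a)"
    "x \<in> Pi\<^sub>E lip_domain W" "Pi\<^sub>E lip_domain W \<subseteq> T"
    unfolding openin_product_topology_alt by fastforce
  define J where "J = {a \<in> lip_domain. W a \<noteq> UNIV}"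
  have "\<exists>r>0. \<forall>y. y \<in> S \<and> rho_L lip_domain L x y < ereal r \<longrightarrow> y a \<in> W a" if a: "a \<in> lip_domain" for a
  proof -
    obtain c where c: "c \<ge> 0" "L a = ereal c" using a by (rule lip_domainE)
    have "x a \<in> W a" using W(3) a by auto
    then obtain e where e: "e > 0" "ball (x a) e \<subseteq> W a" using W(2)[OF a] open_contains_ball by blast
    have "y a \<in> W a" if y: "y \<in> S" "rho_L lip_domain L x y < ereal (e / (c + 1))" for y
    proof -
      have "\<bar>x a - y a\<bar> < (c + 1) * (e / (c + 1))"
        using state_diff_less_of_rho[OF xS y(1) a _ y(2), of c] c by simp
      also have "\<dots> = e" using c by simp
      finally show ?thesis using e(2) by (auto simp: dist_real_def)
    qed
    then show ?thesis using e c by (intro exI[of _ "e / (c + 1)"]) auto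
  qed
  then obtain r where r: "\<And>a. a \<in> lip_domain \<Longrightarrow> r a > 0"
    "\<And>a y. a \<in> lip_domain \<Longrightarrow> y \<in> S \<Longrightarrow> rho_L lip_domain L x y < ereal (r a) \<Longrightarrow> y a \<in> W a"
    by metis
  define s where "s = Min (insert 1 (r ` J))"
  have fin: "finite (insert 1 (r ` J))" using W(1) by (simp add: J_def)
  have s: "s > 0" unfolding s_def using fin r(1) by (subst Min_gr_iff) (auto simp: J_def)
  have "y \<in> U" if y: "y \<in> S" "rho_L lip_domain L x y < ereal s" for y
  proof -
    have "y a \<in> W a" if a: "a \<in> lip_domain" for a
    proof (cases "a \<in> J")
      case True
      then have "s \<le> r a" unfolding s_def using fin by (intro Min_le) auto
      then have "rho_L lip_domain L x y < ereal (r a)" using y(2) by (meson ereal_less_eq(3) less_le_trans)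
      then show ?thesis using r(2) a y(1) by blast
    qed (use a in \<open>simp add: J_def\<close>)
    then have "y \<in> Pi\<^sub>E lip_domain W" using state_extensional[OF y(1)] by (simp add: PiE_iff)
    then show ?thesis using W(4) T(2) y(1) by blast
  qed
  then show ?thesis using s by blast
qed

lemma metric_topology_eq_weak_star:
  "metric_topology_on S (rho_L lip_domain L) = weak_star_topology st lip_domain"
  unfolding topology_eq
proof (intro allI iffI)
  fix U assume U: "openin (metric_topology_on S (rho_L lip_domain L)) U"
  show "openin (weak_star_topology st lip_domain) U"
  proof (subst openin_subopen, intro ballI)
    fix x assume x: "x \<in> U"
    then have "x \<in> S" using U by (auto simp: openin_metric_topology_on)
    obtain r where r: "r > 0" "{y\<in>S. rho_L lip_domain L x y < ereal r} \<subseteq> U"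
      using U x unfolding openin_metric_topology_on by meson
    show "\<exists>T. openin (weak_star_topology st lip_domain) T \<and> x \<in> T \<and> T \<subseteq> U"
      using rho_ball_weak_nhd[OF \<open>x \<in> S\<close> r(1)] r(2) by (meson order_trans)
  qed
next
  fix U assume U: "openin (weak_star_topology st lip_domain) U"
  then have "U \<subseteq> S" using openin_subset topspace_weak_star by blast
  then show "openin (metric_topology_on S (rho_L lip_domain L)) U"
    unfolding openin_metric_topology_on using weak_open_contains_rho_ball[OF U] by blast
qed

lemma lip_norm_L: "lip_norm st lip_domain L"
  unfolding lip_norm_def order_unit_subspace_def
proof (intro conjI ballI allI)
  show "1 \<in> lip_domain" using lip_domain_of_real[of 1] by simp
  fix a assume a: "a \<in> lip_domain"
  show "st a = a" "L a \<noteq> \<infinity>" "L a \<noteq> - \<infinity>" using a by (auto elim: lip_domainE)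
  show "r *\<^sub>R a \<in> lip_domain" "L (r *\<^sub>R a) = ereal \<bar>r\<bar> * L a" for r
    using a by (rule lip_domain_scaleR L_scaleR)+
  fix b assume b: "b \<in> lip_domain"
  show "a + b \<in> lip_domain" using a b by (rule lip_domain_add)
  obtain c d where "L a = ereal c" "L b = ereal d" using a b by (meson lip_domainE)
  then show "L (a + b) \<le> L a + L b" using L_add_le[of a c b d] by simp
qed (rule L_1 metric_topology_eq_weak_star)+

end

theorem theorem2p2:
  fixes sm :: "complex \<Rightarrow> 'a::{real_normed_algebra_1,banach} \<Rightarrow> 'a"
    and st :: "'a \<Rightarrow> 'a"
    and \<alpha> :: "'g::{t2_space,group_add} \<Rightarrow> 'a \<Rightarrow> 'a"
    and l :: "'g \<Rightarrow> real"
  assumes "unital_cstar_algebra sm st"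
    and "compact_group TYPE('g)"
    and "ergodic_strongly_continuous_action sm st \<alpha>"
    and "continuous_length_function l"
  shows "lip_norm st {a. st a = a \<and> lip_seminorm \<alpha> l a < \<infinity>} (lip_seminorm \<alpha> l)"
proof -
  interpret ergodic_action sm st \<alpha> l
    using assms by unfold_locales
  show ?thesis using lip_norm_L by (simp add: lip_domain_def)
qed

end
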